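(* Let $\Omega\subset\mathbb{R}^N$ be a bounded smooth domain and let $M:=\frac12\operatorname{diam}(\Omega)$, where $\operatorname{diam}(\Omega)=\sup\{|x-y|:x,y\in\overline\Omega\}$. Let $g:\overline\Omega\times[0,M]\to\mathbb{R}$, set $G(x,t):=\int_0^t g(x,s)\,ds$, and assume that (G) for every $x\in\Omega$, the function $t\mapsto G(x,\sqrt t)$ is concave in $[0,M^2]$; (g) the function $g$ is continuous in $\overline\Omega\times[0,M]$ and of the form $g=g_1+g_2$, with $g_i(x,0)=0$ for $i=1,2$, where $t\mapsto g_1(x,t)$ is Lipschitz continuous in $[0,M]$ uniformly in $x$, and $g_2$ is continuous and nonnegative in $\overline\Omega\times[0,M]$. Then the problem $$-\operatorname{div}\left(\frac{\nabla u}{\sqrt{1-|\nabla u|^2}}\right)=g(x,u)\ \text{ in }\Omega,\qquad u=0\ \text{ on }\partial\Omega\qquad(\ast)$$ has at most one positive classical solution, that is, the set $\{u\in C^{2,\alpha}(\overline\Omega):\ u>0\text{ in }\Omega\text{ and }u\text{ satisfies }(\ast)\}$ contains at most one element.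
   Context: Here $\alpha\in(0,1)$ is a Hölder exponent, which may differ from one solution to another. Solutions satisfy $|\nabla u|<1$, and any $u\in W^{1,\infty}(\Omega)$ with $|\nabla u|\le1$ and $u=0$ on $\partial\Omega$ satisfies $\|u\|_{L^\infty(\Omega)}\le M$, so that $g(x,u(x))$ is well defined for positive solutions. *)

theory Defs
  imports "HOL-Analysis.Analysis"
begin

definition partial_deriv ::
  "'a::euclidean_space \<Rightarrow> ('a \<Rightarrow> real) \<Rightarrow> 'a \<Rightarrow> real" where
  "partial_deriv b f x = frechet_derivative f (at x) b"

definition grad :: "('a::euclidean_space \<Rightarrow> real) \<Rightarrow> 'a \<Rightarrow> 'a" where
  "grad f x = (\<Sum>b\<in>Basis. partial_deriv b f x *\<^sub>R b)"

definition divergence :: "('a::euclidean_space \<Rightarrow> 'a) \<Rightarrow> 'a \<Rightarrow> real" where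
  "divergence F x = (\<Sum>b\<in>Basis. frechet_derivative F (at x) b \<bullet> b)"

text \<open>
  \<open>Ck_on k U f\<close> is meant for open \<open>U\<close>. The explicit differentiability requirement guards the
  junk values of \<open>frechet_derivative\<close>; together with continuity of the partial derivatives it is
  the usual notion of class \<open>C^k\<close>.
\<close>

primrec Ck_on :: "nat \<Rightarrow> 'a::euclidean_space set \<Rightarrow> ('a \<Rightarrow> real) \<Rightarrow> bool" where
  "Ck_on 0 U f \<longleftrightarrow> continuous_on U f"
| "Ck_on (Suc k) U f \<longleftrightarrow>
     (\<forall>x\<in>U. f differentiable (at x)) \<and> (\<forall>b\<in>Basis. Ck_on k U (partial_deriv b f))"

definition smooth_fun_on :: "'a::euclidean_space set \<Rightarrow> ('a \<Rightarrow> real) \<Rightarrow> bool" where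
  "smooth_fun_on U f \<longleftrightarrow> (\<forall>k. Ck_on k U f)"

text \<open>
  A bounded smooth domain: near each boundary point it is the sublevel set of a smooth defining
  function with nonvanishing gradient. Then, inside \<open>U\<close>, the boundary is exactly the zero set
  of \<open>\<rho>\<close>, a smooth hypersurface with the domain on one side only.
\<close>

definition bounded_smooth_domain :: "'a::euclidean_space set \<Rightarrow> bool" where
  "bounded_smooth_domain \<Omega> \<longleftrightarrow>
     \<Omega> \<noteq> {} \<and> open \<Omega> \<and> connected \<Omega> \<and> bounded \<Omega> \<and>
     (\<forall>p\<in>frontier \<Omega>. \<exists>U \<rho>. open U \<and> p \<in> U \<and> smooth_fun_on U \<rho> \<and>
        (\<forall>x\<in>U. grad \<rho> x \<noteq> 0) \<and> \<Omega> \<inter> U = {x\<in>U. \<rho> x < 0})"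

definition extends_continuously_to_closure ::
  "'a::euclidean_space set \<Rightarrow> ('a \<Rightarrow> real) \<Rightarrow> bool" where
  "extends_continuously_to_closure \<Omega> f \<longleftrightarrow>
     (\<exists>h. continuous_on (closure \<Omega>) h \<and> (\<forall>x\<in>\<Omega>. h x = f x))"

definition Holder_on :: "real \<Rightarrow> 'a::euclidean_space set \<Rightarrow> ('a \<Rightarrow> real) \<Rightarrow> bool" where
  "Holder_on \<alpha> S f \<longleftrightarrow>
     (\<exists>C. \<forall>x\<in>S. \<forall>y\<in>S. \<bar>f x - f y\<bar> \<le> C * dist x y powr \<alpha>)"

text \<open>
  The space \<open>C^{2,\<alpha>}\<close> on the closure of \<open>\<Omega>\<close>: derivatives are taken in the open set \<open>\<Omega>\<close> only and
  extend continuously to the closure. Values of \<open>u\<close> off the closure are irrelevant.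
\<close>

definition C2_Holder_closure ::
  "real \<Rightarrow> 'a::euclidean_space set \<Rightarrow> ('a \<Rightarrow> real) \<Rightarrow> bool" where
  "C2_Holder_closure \<alpha> \<Omega> u \<longleftrightarrow>
     continuous_on (closure \<Omega>) u \<and> Ck_on 2 \<Omega> u \<and>
     (\<forall>i\<in>Basis. extends_continuously_to_closure \<Omega> (partial_deriv i u)) \<and>
     (\<forall>i\<in>Basis. \<forall>j\<in>Basis.
        extends_continuously_to_closure \<Omega> (partial_deriv i (partial_deriv j u)) \<and>
        Holder_on \<alpha> \<Omega> (partial_deriv i (partial_deriv j u)))"

text \<open>
  The requirement \<open>|\<nabla>u| < 1\<close> is imposed in \<open>\<Omega>\<close> only, where the equation has to make sense. The
  term \<open>g x (u x)\<close> only uses values of \<open>g\<close> with second argument between \<open>0\<close> and half the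
  diameter, because \<open>|\<nabla>u| < 1\<close> and \<open>u = 0\<close> on the boundary.
\<close>

definition positive_classical_solution ::
  "'a::euclidean_space set \<Rightarrow> ('a \<Rightarrow> real \<Rightarrow> real) \<Rightarrow> ('a \<Rightarrow> real) \<Rightarrow> bool" where
  "positive_classical_solution \<Omega> g u \<longleftrightarrow>
     (\<exists>\<alpha>. 0 < \<alpha> \<and> \<alpha> < 1 \<and> C2_Holder_closure \<alpha> \<Omega> u) \<and>
     (\<forall>x\<in>\<Omega>. u x > 0) \<and>
     (\<forall>x\<in>\<Omega>. norm (grad u x) < 1) \<and>
     (\<forall>x\<in>\<Omega>. - divergence (\<lambda>y. grad u y /\<^sub>R sqrt (1 - (norm (grad u y))\<^sup>2)) x = g x (u x)) \<and>
     (\<forall>x\<in>frontier \<Omega>. u x = 0)"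

end

theory Submission
  imports Defs
begin

text \<open>
  Put \<open>U = u + \<epsilon>\<close>, \<open>V = v + \<epsilon>\<close> and test the equation of \<open>u\<close> with \<open>(U\<^sup>2 - V\<^sup>2) / U\<close>, that of \<open>v\<close> with
  \<open>(V\<^sup>2 - U\<^sup>2) / V\<close>. By a Picone type inequality the sum of the gradient terms is bounded below by
  nonnegative continuous functions not depending on \<open>\<epsilon>\<close>, which vanish only where the two gradients
  agree. The sum of the reaction terms tends pointwise to \<open>(u\<^sup>2 - v\<^sup>2) (g(x,u)/u - g(x,v)/v)\<close>, which is
  nonpositive since (G) makes \<open>g(x,t)/t\<close> nonincreasing; by (g), \<open>g(x,t) \<ge> - L t\<close>, so these terms are
  bounded above uniformly in \<open>\<epsilon>\<close> and dominated convergence applies to their positive parts. Hence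
  the gradients of \<open>u\<close> and \<open>v\<close> coincide. The shift by \<open>\<epsilon>\<close> keeps the test functions Lipschitz without
  any comparison of \<open>u\<close> and \<open>v\<close> at the boundary, so Hopf's lemma and boundary regularity are avoided.
\<close>


section \<open>Integration by parts against compactly supported test functions\<close>

text \<open>By translation invariance of Lebesgue measure every difference quotient of
  \<open>h\<close> in direction \<open>b\<close> has integral 0. The mean value theorem bounds the
  quotients by \<open>C\<close>, so dominated convergence carries this over to the
  derivative.\<close>

lemma integral_directional_derivative_eq_0:
  fixes h :: "'a::euclidean_space \<Rightarrow> real"
  assumes der: "\<And>x. (h has_derivative h' x) (at x)"
    and bnd: "\<And>x. \<bar>h' x b\<bar> \<le> C"
    and supp: "\<And>x. x \<notin> K \<Longrightarrow> h x = 0" and K: "bounded K"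
  shows "(\<integral>x. h' x b \<partial>lborel) = 0"
proof -
  define t :: "nat \<Rightarrow> real" where "t n = inverse (Suc n)" for n
  define s where "s n x = (h (x + t n *\<^sub>R b) - h x) / t n" for n x
  have t_pos: "t n > 0" and t_le: "t n \<le> 1" for n
    by (auto simp: t_def field_simps)
  have t_lim: "t \<longlonglongrightarrow> 0"
    unfolding t_def by (rule LIMSEQ_inverse_real_of_nat)
  have line: "((\<lambda>r. h (x + r *\<^sub>R b)) has_field_derivative h' (x + r *\<^sub>R b) b) (at r)" for x r
  proof -
    have "((\<lambda>r. h (x + r *\<^sub>R b)) has_derivative (\<lambda>d. h' (x + r *\<^sub>R b) (d *\<^sub>R b))) (at r)"
      by (rule has_derivative_compose[OF _ der]) (auto intro!: derivative_eq_intros)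
    moreover have "h' y (d *\<^sub>R b) = h' y b * d" for y d
      using linear_cmul[OF has_derivative_linear[OF der]] by simp
    ultimately show ?thesis
      by (simp add: has_field_derivative_def fun_eq_iff)
  qed
  have quot_bound: "\<bar>s n x\<bar> \<le> C" for n x
  proof -
    have "\<exists>r. 0 < r \<and> r < t n \<and> h (x + t n *\<^sub>R b) - h (x + 0 *\<^sub>R b) = (t n - 0) * h' (x + r *\<^sub>R b) b"
      by (rule MVT2) (use t_pos line in auto)
    then obtain r where "h (x + t n *\<^sub>R b) - h x = t n * h' (x + r *\<^sub>R b) b"
      by auto
    then have "s n x = h' (x + r *\<^sub>R b) b"
      using t_pos[of n] by (simp add: s_def)
    then show ?thesis using bnd by simp
  qed
  obtain R where R: "\<And>x. x \<in> K \<Longrightarrow> norm x \<le> R"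
    using K by (auto simp: bounded_iff)
  \<comment> \<open>Since \<open>t n \<le> 1\<close>, a quotient can be nonzero only within distance
    \<open>norm b\<close> of the support, so one ball serves for all \<open>n\<close>.\<close>
  have s_dom: "norm (s n x) \<le> indicat_real (cball 0 (R + norm b)) x *\<^sub>R C" for n x
  proof (cases "x \<in> cball 0 (R + norm b)")
    case True
    then show ?thesis using quot_bound by simp
  next
    case False
    then have x: "norm x > R + norm b" by simp
    have "x \<notin> K"
      using R[of x] x norm_ge_zero[of b] by linarith
    moreover have "x + t n *\<^sub>R b \<notin> K"
    proof
      assume "x + t n *\<^sub>R b \<in> K"
      then have "norm (x + t n *\<^sub>R b) \<le> R" by (rule R)
      moreover have "norm x \<le> norm (x + t n *\<^sub>R b) + norm (t n *\<^sub>R b)"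
        by (metis norm_triangle_ineq4 add_diff_cancel_right')
      moreover have "norm (t n *\<^sub>R b) \<le> norm b"
        using t_pos[of n] t_le[of n] by (simp add: mult_left_le_one_le)
      ultimately show False using x by linarith
    qed
    ultimately show ?thesis using False by (simp add: s_def supp indicator_def)
  qed
  have s_lim: "(\<lambda>n. s n x) \<longlonglongrightarrow> h' x b" for x
  proof -
    have "((\<lambda>d. (h (x + d *\<^sub>R b) - h x) / d) \<longlongrightarrow> h' x b) (at 0)"
      using line[of x 0] by (simp add: DERIV_def)
    moreover have "filterlim t (at 0) sequentially"
      unfolding filterlim_at using t_lim t_pos by (auto intro!: always_eventually simp: less_imp_neq[THEN not_sym])
    ultimately show ?thesis
      unfolding s_def by (rule filterlim_compose)
  qed
  have h_cont: "continuous_on UNIV h"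
    using der by (meson has_derivative_continuous continuous_at_imp_continuous_on)
  then have h_meas[measurable]: "h \<in> borel_measurable borel"
    by (rule borel_measurable_continuous_onI)
  have s_meas[measurable]: "s n \<in> borel_measurable lborel" for n
    unfolding s_def by measurable
  \<comment> \<open>\<open>h'\<close> is merely bounded; it is measurable as the pointwise limit of
    the quotients.\<close>
  have h'_meas: "(\<lambda>x. h' x b) \<in> borel_measurable lborel"
    by (rule borel_measurable_LIMSEQ_real[OF s_lim]) auto
  have h_int: "integrable lborel h"
  proof -
    have "integrable lborel (\<lambda>x. indicator (cball 0 R) x *\<^sub>R h x)"
      by (rule borel_integrable_compact) (auto intro: continuous_on_subset[OF h_cont])
    moreover have "(\<lambda>x. indicator (cball 0 R) x *\<^sub>R h x) = h"
      using R supp by (auto simp: fun_eq_iff indicator_def)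
    ultimately show ?thesis by simp
  qed
  have shift: "integrable lborel (\<lambda>x. h (x + c))" "(\<integral>x. h (x + c) \<partial>lborel) = (\<integral>x. h x \<partial>lborel)" for c
  proof -
    have *: "distr lborel borel ((+) c) = lborel"
      by (rule lborel_distr_plus)
    have "integrable (distr lborel borel ((+) c)) h" using h_int by (simp add: *)
    then show "integrable lborel (\<lambda>x. h (x + c))"
      by (subst (asm) integrable_distr_eq) (auto simp: add.commute)
    have "(\<integral>x. h x \<partial>distr lborel borel ((+) c)) = (\<integral>x. h (c + x) \<partial>lborel)"
      by (rule integral_distr) auto
    then show "(\<integral>x. h (x + c) \<partial>lborel) = (\<integral>x. h x \<partial>lborel)"
      by (simp add: * add.commute)
  qed
  have "(\<integral>x. s n x \<partial>lborel) = 0" for n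
    unfolding s_def using shift h_int by simp
  moreover have "(\<lambda>n. \<integral>x. s n x \<partial>lborel) \<longlonglongrightarrow> (\<integral>x. h' x b \<partial>lborel)"
  proof (rule integral_dominated_convergence[OF h'_meas s_meas])
    show "integrable lborel (\<lambda>x. indicat_real (cball 0 (R + norm b)) x *\<^sub>R C)"
      by (rule borel_integrable_compact) auto
  qed (use s_lim s_dom in auto)
  ultimately show ?thesis
    by (simp add: LIMSEQ_const_iff)
qed


lemma measurable_continuous_lborel_restrict:
  fixes f :: "'a::euclidean_space \<Rightarrow> 'b::topological_space"
  assumes "continuous_on A f"
  shows "f \<in> borel_measurable (restrict_space lborel A)"
  using borel_measurable_continuous_on_restrict[OF assms]
  by (simp add: measurable_def space_restrict_space sets_restrict_space)

lemma integrable_vanishing_off_compact: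
  fixes f :: "'a::euclidean_space \<Rightarrow> real"
  assumes "open A" "compact K" "K \<subseteq> A" "continuous_on A f"
    and zero: "\<And>x. x \<in> A - K \<Longrightarrow> f x = 0"
  shows "integrable (restrict_space lborel A) f"
proof -
  have "integrable lborel (\<lambda>x. indicator K x *\<^sub>R f x)"
    by (rule borel_integrable_compact) (use assms in \<open>auto intro: continuous_on_subset\<close>)
  moreover have "(\<lambda>x. indicator K x *\<^sub>R f x) = (\<lambda>x. indicator A x *\<^sub>R f x)"
    using assms by (auto simp: fun_eq_iff indicator_def)
  ultimately show ?thesis
    using assms by (subst integrable_restrict_space) auto
qed

text \<open>The gradient is an explicit argument, so that the formula computed for a test function
  is the one that appears under the integral.\<close>

definition C1_gradient_on :: "'a::euclidean_space set \<Rightarrow> ('a \<Rightarrow> real) \<Rightarrow> ('a \<Rightarrow> 'a) \<Rightarrow> bool" where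
  "C1_gradient_on A f D \<longleftrightarrow>
     (\<forall>x\<in>A. (f has_derivative (\<lambda>h. D x \<bullet> h)) (at x)) \<and> continuous_on A D"

definition C1_field_on :: "'a::euclidean_space set \<Rightarrow> ('a \<Rightarrow> 'a) \<Rightarrow> bool" where
  "C1_field_on A F \<longleftrightarrow>
     (\<forall>x\<in>A. F differentiable (at x)) \<and>
     (\<forall>b\<in>Basis. continuous_on A (\<lambda>x. frechet_derivative F (at x) b))"

lemma C1_gradient_onD:
  assumes "C1_gradient_on A f D"
  shows "x \<in> A \<Longrightarrow> (f has_derivative (\<lambda>h. D x \<bullet> h)) (at x)"
    and "continuous_on A D" and "continuous_on A f"
  using assms unfolding C1_gradient_on_def
  by (auto intro: continuous_at_imp_continuous_on has_derivative_continuous)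

lemma C1_field_onD:
  assumes "C1_field_on A F"
  shows "x \<in> A \<Longrightarrow> F differentiable (at x)"
    and "b \<in> Basis \<Longrightarrow> continuous_on A (\<lambda>x. frechet_derivative F (at x) b)"
    and "continuous_on A F" and "continuous_on A (divergence F)"
proof -
  show "x \<in> A \<Longrightarrow> F differentiable (at x)"
    and cont: "b \<in> Basis \<Longrightarrow> continuous_on A (\<lambda>x. frechet_derivative F (at x) b)" for x b
    using assms by (auto simp: C1_field_on_def)
  then show "continuous_on A F"
    by (auto intro: continuous_at_imp_continuous_on differentiable_imp_continuous_within)
  show "continuous_on A (divergence F)"
    unfolding divergence_def by (intro continuous_intros cont)
qed

text \<open>For each basis vector \<open>b\<close> the product of \<open>\<phi>\<close> and the
  component \<open>F x \<bullet> b\<close>, extended by 0, is differentiable on the whole space, so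
  its derivative in direction \<open>b\<close> integrates to 0. Summing over the basis gives the
  divergence theorem without a boundary integral.\<close>

lemma divergence_integral_compact_support:
  fixes \<phi> :: "'a::euclidean_space \<Rightarrow> real" and D F :: "'a \<Rightarrow> 'a"
  assumes A: "open A" and K: "compact K" "K \<subseteq> A"
    and zero: "\<And>x. x \<in> A - K \<Longrightarrow> \<phi> x = 0" "\<And>x. x \<in> A - K \<Longrightarrow> D x = 0"
    and test: "C1_gradient_on A \<phi> D" and field: "C1_field_on A F"
  shows "integrable (restrict_space lborel A) (\<lambda>x. D x \<bullet> F x)"
    and "integrable (restrict_space lborel A) (\<lambda>x. \<phi> x * divergence F x)"
    and "(\<integral>x. D x \<bullet> F x \<partial>restrict_space lborel A) = - (\<integral>x. \<phi> x * divergence F x \<partial>restrict_space lborel A)"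
proof -
  let ?\<mu> = "restrict_space lborel A"
  note \<phi> = C1_gradient_onD(1)[OF test] and D = C1_gradient_onD(2)[OF test]
    and \<phi>_cont = C1_gradient_onD(3)[OF test]
  note F = C1_field_onD(1)[OF field] and F' = C1_field_onD(2)[OF field]
    and F_cont = C1_field_onD(3)[OF field] and div_cont = C1_field_onD(4)[OF field]
  show int1: "integrable ?\<mu> (\<lambda>x. D x \<bullet> F x)"
    by (rule integrable_vanishing_off_compact[OF A K]) (use zero in \<open>auto intro!: continuous_intros D F_cont\<close>)
  show int2: "integrable ?\<mu> (\<lambda>x. \<phi> x * divergence F x)"
    by (rule integrable_vanishing_off_compact[OF A K]) (use zero in \<open>auto intro!: continuous_intros \<phi>_cont div_cont\<close>)
  \<comment> \<open>\<open>q b\<close> is the derivative in direction \<open>b\<close> of the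
    product of \<open>\<phi>\<close> and the \<open>b\<close>-component of \<open>F\<close>; the sum
    over \<open>b\<close> is \<open>D x \<bullet> F x + \<phi> x * divergence F x\<close>.\<close>
  define q where "q b x = (D x \<bullet> b) * (F x \<bullet> b) + \<phi> x * (frechet_derivative F (at x) b \<bullet> b)" for b x
  have q_cont: "continuous_on A (q b)" if "b \<in> Basis" for b
    unfolding q_def using that by (intro continuous_intros D F_cont \<phi>_cont F')
  have q_int: "integrable ?\<mu> (q b)" if "b \<in> Basis" for b
    by (rule integrable_vanishing_off_compact[OF A K q_cont[OF that]]) (use zero in \<open>auto simp: q_def\<close>)
  have q_zero: "(\<integral>x. q b x \<partial>?\<mu>) = 0" if b: "b \<in> Basis" for b
  proof -
    define h where "h x = (if x \<in> A then \<phi> x * (F x \<bullet> b) else 0)" for x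
    define h' where "h' x d = (if x \<in> A then (D x \<bullet> d) * (F x \<bullet> b) + \<phi> x * (frechet_derivative F (at x) d \<bullet> b) else 0)" for x d
    have "bounded (q b ` K)"
      by (intro compact_imp_bounded compact_continuous_image K continuous_on_subset[OF q_cont[OF b] K(2)])
    then obtain C where C: "\<And>x. x \<in> K \<Longrightarrow> \<bar>q b x\<bar> \<le> C"
      by (auto simp: bounded_iff)
    have "(\<integral>x. h' x b \<partial>lborel) = 0"
    proof (rule integral_directional_derivative_eq_0)
      fix x
      show "(h has_derivative h' x) (at x)"
      proof (cases "x \<in> A")
        case True
        have "((\<lambda>x. \<phi> x * (F x \<bullet> b)) has_derivative h' x) (at x)"
          using True
          by (auto intro!: derivative_eq_intros \<phi> F[THEN frechet_derivative_works[THEN iffD1]] simp: h'_def fun_eq_iff)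
        then show ?thesis
          by (rule has_derivative_transform_within_open[OF _ A True]) (simp add: h_def)
      next
        case False
        \<comment> \<open>A point outside \<open>A\<close> has the open set \<open>- K\<close> as a
          neighbourhood, and there the extension is identically 0.\<close>
        have opn: "open (- K)" using K by (simp add: compact_imp_closed open_Compl)
        have "((\<lambda>x. 0) has_derivative h' x) (at x)"
          unfolding h'_def using False by simp
        then show ?thesis
          by (rule has_derivative_transform_within_open[OF _ opn]) (use False K zero in \<open>auto simp: h_def\<close>)
      qed
      \<comment> \<open>The maximum with 0 covers the points off \<open>K\<close>, since
        \<open>C\<close> may be negative if \<open>K\<close> is empty.\<close>
      show "\<bar>h' x b\<bar> \<le> max C 0"
        using C[of x] zero[of x] by (cases "x \<in> K") (auto simp: h'_def q_def le_max_iff_disj)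
    next
      show "bounded K" using K by (simp add: compact_imp_bounded)
      show "\<And>x. x \<notin> K \<Longrightarrow> h x = 0" using zero by (auto simp: h_def)
    qed
    moreover have "(\<lambda>x. h' x b) = (\<lambda>x. indicator A x *\<^sub>R q b x)"
      by (auto simp: h'_def q_def fun_eq_iff)
    ultimately show ?thesis
      using A by (subst integral_restrict_space) auto
  qed
  have "(\<integral>x. D x \<bullet> F x \<partial>?\<mu>) + (\<integral>x. \<phi> x * divergence F x \<partial>?\<mu>)
      = (\<integral>x. D x \<bullet> F x + \<phi> x * divergence F x \<partial>?\<mu>)"
    using int1 int2 by simp
  also have "\<dots> = (\<integral>x. (\<Sum>b\<in>Basis. q b x) \<partial>?\<mu>)"
    by (subst euclidean_inner) (simp add: q_def divergence_def sum.distrib sum_distrib_left)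
  also have "\<dots> = (\<Sum>b\<in>Basis. \<integral>x. q b x \<partial>?\<mu>)"
    by (rule Bochner_Integration.integral_sum) (rule q_int)
  also have "\<dots> = 0"
    by (simp add: q_zero)
  finally show "(\<integral>x. D x \<bullet> F x \<partial>?\<mu>) = - (\<integral>x. \<phi> x * divergence F x \<partial>?\<mu>)"
    by simp
qed


section \<open>Cutoffs built from a function that vanishes on the boundary\<close>

text \<open>Squaring removes the corner of the positive part at 0; this is why the cutoff profile is
  a square.\<close>

lemma positive_part_square_derivative:
  "((\<lambda>t::real. (max 0 t)\<^sup>2) has_real_derivative 2 * max 0 t) (at t)"
proof -
  consider "t > 0" | "t < 0" | "t = 0" by linarith
  then show ?thesis
  proof cases
    case 1
    have "((\<lambda>t. t\<^sup>2) has_real_derivative 2 * max 0 t) (at t)"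
      using 1 by (auto intro!: derivative_eq_intros)
    then show ?thesis
      by (rule has_field_derivative_transform_within_open[where S = "{0<..}"]) (use 1 in auto)
  next
    case 2
    have "((\<lambda>t. 0) has_real_derivative 2 * max 0 t) (at t)"
      using 2 by (auto intro!: derivative_eq_intros)
    then show ?thesis
      by (rule has_field_derivative_transform_within_open[where S = "{..<0}"]) (use 2 in auto)
  next
    case 3
    have "((\<lambda>h::real. (max 0 h)\<^sup>2 / h) \<longlongrightarrow> 0) (at 0)"
    proof (rule Lim_null_comparison)
      show "\<forall>\<^sub>F h::real in at 0. norm ((max 0 h)\<^sup>2 / h) \<le> \<bar>h\<bar>"
        by (rule always_eventually) (auto simp: max_def power2_eq_square)
      show "((\<lambda>h::real. \<bar>h\<bar>) \<longlongrightarrow> 0) (at 0)"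
        by (rule tendsto_eq_intros | simp)+
    qed
    then show ?thesis using 3 by (simp add: DERIV_def)
  qed
qed

text \<open>
  The cutoff acts on a positive function \<open>z\<close> that vanishes on the boundary. This profile is \<open>C\<^sup>1\<close> and
  satisfies \<open>z cutoff' \<delta> z \<le> 2\<close> uniformly in \<open>\<delta>\<close>, so for \<open>|w| \<le> c z\<close> the error term
  \<open>w cutoff' \<delta> z\<close> stays bounded.
\<close>

definition cutoff :: "real \<Rightarrow> real \<Rightarrow> real" where
  "cutoff \<delta> s = (max 0 (1 - \<delta> / s))\<^sup>2"

definition cutoff' :: "real \<Rightarrow> real \<Rightarrow> real" where
  "cutoff' \<delta> s = 2 * max 0 (1 - \<delta> / s) * (\<delta> / s\<^sup>2)"

lemma cutoff_derivative:
  assumes "s > 0" shows "(cutoff \<delta> has_real_derivative cutoff' \<delta> s) (at s)"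
proof -
  have "((\<lambda>s. 1 - \<delta> / s) has_real_derivative \<delta> / s\<^sup>2) (at s)"
    using assms by (auto intro!: derivative_eq_intros simp: power2_eq_square)
  from DERIV_chain2[OF positive_part_square_derivative this] show ?thesis
    unfolding cutoff_def[abs_def] cutoff'_def .
qed

lemma cutoff_bounds:
  assumes "s > 0" "\<delta> > 0"
  shows "0 \<le> cutoff \<delta> s" "cutoff \<delta> s \<le> 1" "0 \<le> cutoff' \<delta> s" "s * cutoff' \<delta> s \<le> 2"
proof -
  let ?m = "max 0 (1 - \<delta> / s)"
  have m: "0 \<le> ?m" "?m \<le> 1" using assms by auto
  show "0 \<le> cutoff \<delta> s" "cutoff \<delta> s \<le> 1" "0 \<le> cutoff' \<delta> s"
    using m assms by (auto simp: cutoff_def cutoff'_def power_le_one)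
  \<comment> \<open>For \<open>\<delta> \<le> s\<close> both factors are at most 1; otherwise
    \<open>?m\<close> is 0.\<close>
  have "?m * (\<delta> / s) \<le> 1"
  proof (cases "\<delta> / s \<le> 1")
    case True
    then show ?thesis using m assms by (intro mult_le_one) auto
  qed simp
  moreover have "s * cutoff' \<delta> s = 2 * (?m * (\<delta> / s))"
    using assms by (simp add: cutoff'_def power2_eq_square)
  ultimately show "s * cutoff' \<delta> s \<le> 2" by linarith
qed

lemma cutoff_eq_0: "0 < s \<Longrightarrow> s \<le> \<delta> \<Longrightarrow> cutoff \<delta> s = 0" "0 < s \<Longrightarrow> s \<le> \<delta> \<Longrightarrow> cutoff' \<delta> s = 0"
  by (auto simp: cutoff_def cutoff'_def)

lemma cutoff_tendsto:
  assumes "s > 0"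
  shows "(\<lambda>n. cutoff (inverse (Suc n)) s) \<longlonglongrightarrow> 1" "(\<lambda>n. cutoff' (inverse (Suc n)) s) \<longlonglongrightarrow> 0"
proof -
  have *: "(\<lambda>n. inverse (real (Suc n)) / t) \<longlonglongrightarrow> 0" for t :: real
    using tendsto_divide_zero[OF LIMSEQ_inverse_real_of_nat] .
  have m: "(\<lambda>n. max 0 (1 - inverse (real (Suc n)) / s)) \<longlonglongrightarrow> 1"
    using tendsto_max[OF tendsto_const[of 0] tendsto_diff[OF tendsto_const[of 1] *[of s]]] by simp
  show "(\<lambda>n. cutoff (inverse (Suc n)) s) \<longlonglongrightarrow> 1"
    unfolding cutoff_def using tendsto_power[OF m, of 2] by simp
  show "(\<lambda>n. cutoff' (inverse (Suc n)) s) \<longlonglongrightarrow> 0"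
    unfolding cutoff'_def
    using tendsto_mult[OF tendsto_mult[OF tendsto_const[of 2] m] *[of "s\<^sup>2"]] by simp
qed

text \<open>The test function is \<open>cutoff \<delta> (z x) * w x\<close>. It vanishes where
  \<open>z x \<le> \<delta>\<close>, and since \<open>z\<close> is 0 on the frontier, what remains
  lies in a compact subset of \<open>A\<close>. No regularity of the frontier enters; the second
  summand is the error from differentiating the cutoff.\<close>

lemma divergence_integral_cutoff:
  fixes z w :: "'a::euclidean_space \<Rightarrow> real"
  assumes A: "open A" "bounded A"
    and z_cont: "continuous_on (closure A) z" and z_frontier: "\<And>x. x \<in> frontier A \<Longrightarrow> z x = 0"
    and z_pos: "\<And>x. x \<in> A \<Longrightarrow> z x > 0"
    and z: "C1_gradient_on A z Dz" and w: "C1_gradient_on A w Dw" and F: "C1_field_on A F"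
    and \<delta>: "\<delta> > 0"
  shows "integrable (restrict_space lborel A) (\<lambda>x. cutoff \<delta> (z x) * (Dw x \<bullet> F x) + cutoff' \<delta> (z x) * (w x * (Dz x \<bullet> F x)))"
    and "integrable (restrict_space lborel A) (\<lambda>x. cutoff \<delta> (z x) * (w x * divergence F x))"
    and "(\<integral>x. cutoff \<delta> (z x) * (Dw x \<bullet> F x) + cutoff' \<delta> (z x) * (w x * (Dz x \<bullet> F x)) \<partial>restrict_space lborel A)
      = - (\<integral>x. cutoff \<delta> (z x) * (w x * divergence F x) \<partial>restrict_space lborel A)"
proof -
  define K where "K = {x \<in> closure A. \<delta> \<le> z x}"
  have "closed {x \<in> closure A. z x \<in> {\<delta>..}}"
    using continuous_closed_preimage[OF z_cont closed_closure closed_atLeast]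
    by (simp add: vimage_def Int_def)
  then have "closed K" by (simp add: K_def)
  then have "compact K"
    using A unfolding K_def
    by (metis (no_types, lifting) bounded_closure bounded_subset compact_eq_bounded_closed mem_Collect_eq subsetI)
  moreover have "K \<subseteq> A"
    using \<delta> z_frontier A(1) unfolding K_def frontier_def by (force simp: interior_open)
  ultimately have K: "compact K" "K \<subseteq> A" by auto
  define D where "D x = cutoff \<delta> (z x) *\<^sub>R Dw x + (cutoff' \<delta> (z x) * w x) *\<^sub>R Dz x" for x
  have zero: "cutoff \<delta> (z x) = 0" "cutoff' \<delta> (z x) = 0" if "x \<in> A - K" for x
    using that z_pos[of x] closure_subset[of A] by (auto simp: K_def intro: cutoff_eq_0)
  have grad: "C1_gradient_on A (\<lambda>x. cutoff \<delta> (z x) * w x) D"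
    unfolding C1_gradient_on_def
  proof (intro conjI ballI)
    fix x assume x: "x \<in> A"
    have "((\<lambda>x. cutoff \<delta> (z x)) has_derivative (\<lambda>h. (Dz x \<bullet> h) * cutoff' \<delta> (z x))) (at x)"
      using has_derivative_compose[OF C1_gradient_onD(1)[OF z x]
          cutoff_derivative[OF z_pos[OF x], unfolded has_field_derivative_def]]
      by (simp add: mult.commute)
    from has_derivative_mult[OF this C1_gradient_onD(1)[OF w x]]
    show "((\<lambda>x. cutoff \<delta> (z x) * w x) has_derivative (\<lambda>h. D x \<bullet> h)) (at x)"
      by (simp add: D_def inner_add_left algebra_simps)
  next
    show "continuous_on A D"
      unfolding D_def cutoff_def cutoff'_def using z_pos
      by (intro continuous_intros C1_gradient_onD(2)[OF z] C1_gradient_onD(2)[OF w]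
          C1_gradient_onD(3)[OF z] C1_gradient_onD(3)[OF w]) (auto simp: less_imp_neq[THEN not_sym])
  qed
  have D_F: "D x \<bullet> F x = cutoff \<delta> (z x) * (Dw x \<bullet> F x) + cutoff' \<delta> (z x) * (w x * (Dz x \<bullet> F x))" for x
    by (simp add: D_def inner_add_left)
  have zeroD: "cutoff \<delta> (z x) * w x = 0" "D x = 0" if "x \<in> A - K" for x
    using zero[OF that] by (auto simp: D_def)
  note * = divergence_integral_compact_support[OF A(1) K zeroD grad F, unfolded D_F mult.assoc]
  show "integrable (restrict_space lborel A) (\<lambda>x. cutoff \<delta> (z x) * (Dw x \<bullet> F x) + cutoff' \<delta> (z x) * (w x * (Dz x \<bullet> F x)))"
    by (rule *(1))
  show "integrable (restrict_space lborel A) (\<lambda>x. cutoff \<delta> (z x) * (w x * divergence F x))"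
    by (rule *(2))
  show "(\<integral>x. cutoff \<delta> (z x) * (Dw x \<bullet> F x) + cutoff' \<delta> (z x) * (w x * (Dz x \<bullet> F x)) \<partial>restrict_space lborel A)
      = - (\<integral>x. cutoff \<delta> (z x) * (w x * divergence F x) \<partial>restrict_space lborel A)"
    by (rule *(3))
qed


section \<open>Removing the cutoff: integrability of the field and integration by parts up to the
  boundary\<close>

lemma finite_measure_lborel_restrict:
  assumes "bounded A" "open A"
  shows "finite_measure (restrict_space (lborel :: 'a::euclidean_space measure) A)"
  using assms emeasure_bounded_finite[of A]
  by (intro finite_measureI) (simp add: emeasure_restrict_space space_restrict_space)

text \<open>
  A spacelike gradient may approach norm \<open>1\<close> at the boundary, where the flux blows up; its
  integrability comes from testing the equation with \<open>u\<close> itself.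
\<close>

lemma integrable_gradient_flux:
  fixes u :: "'a::euclidean_space \<Rightarrow> real"
  assumes A: "open A" "bounded A"
    and u_cont: "continuous_on (closure A) u" and u_frontier: "\<And>x. x \<in> frontier A \<Longrightarrow> u x = 0"
    and u_pos: "\<And>x. x \<in> A \<Longrightarrow> u x > 0"
    and u: "C1_gradient_on A u Du" and F: "C1_field_on A F"
    and nonneg: "\<And>x. x \<in> A \<Longrightarrow> 0 \<le> Du x \<bullet> F x"
    and div: "\<And>x. x \<in> A \<Longrightarrow> \<bar>divergence F x\<bar> \<le> C"
  shows "integrable (restrict_space lborel A) (\<lambda>x. Du x \<bullet> F x)"
proof -
  let ?\<mu> = "restrict_space lborel A"
  interpret finite_measure ?\<mu> by (rule finite_measure_lborel_restrict[OF A(2,1)])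
  define d :: "nat \<Rightarrow> real" where "d n = inverse (Suc n)" for n
  have d_pos: "d n > 0" for n by (simp add: d_def)
  \<comment> \<open>This pairs \<open>F\<close> with the gradient of the test function
    \<open>cutoff (d n) (u x) * u x\<close>. Both summands are nonnegative, so the error term needs
    no control from above and Fatou's lemma suffices.\<close>
  define s where "s n x = cutoff (d n) (u x) * (Du x \<bullet> F x) + cutoff' (d n) (u x) * (u x * (Du x \<bullet> F x))" for n x
  have in_A: "x \<in> A" if "x \<in> space ?\<mu>" for x
    using that by (simp add: space_restrict_space)
  have "bounded (u ` closure A)"
    using A by (intro compact_imp_bounded compact_continuous_image u_cont) (simp add: compact_closure)
  then obtain B where B: "\<And>x. x \<in> closure A \<Longrightarrow> \<bar>u x\<bar> \<le> B"
    by (auto simp: bounded_iff)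
  note ibp = divergence_integral_cutoff[OF A u_cont u_frontier u_pos u u F d_pos]
  have s_nonneg: "0 \<le> s n x" if "x \<in> A" for n x
    using cutoff_bounds[OF u_pos[OF that] d_pos[of n]] nonneg[OF that] u_pos[OF that]
    by (simp add: s_def)
  have s_int: "integrable ?\<mu> (s n)" for n
    unfolding s_def by (rule ibp(1))
  \<comment> \<open>After integration by parts only \<open>u\<close> and the divergence remain, both
    bounded on a set of finite measure; the bound does not depend on \<open>n\<close>.\<close>
  have s_bound: "(\<integral>\<^sup>+x. ennreal (s n x) \<partial>?\<mu>) \<le> ennreal (B * C * measure ?\<mu> (space ?\<mu>))" for n
  proof -
    have "(\<integral>x. s n x \<partial>?\<mu>) = (\<integral>x. - (cutoff (d n) (u x) * (u x * divergence F x)) \<partial>?\<mu>)"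
      unfolding s_def using ibp(3)[of n] by simp
    also have "\<dots> \<le> (\<integral>x. B * C \<partial>?\<mu>)"
    proof (rule integral_mono)
      fix x assume "x \<in> space ?\<mu>"
      then have x: "x \<in> A" by (rule in_A)
      then have "x \<in> closure A" using closure_subset by auto
      note b = B[OF this] div[OF x] cutoff_bounds(1,2)[OF u_pos[OF x] d_pos[of n]]
      have "\<bar>cutoff (d n) (u x) * (u x * divergence F x)\<bar> \<le> 1 * (B * C)"
        unfolding abs_mult using b by (intro mult_mono) auto
      then show "- (cutoff (d n) (u x) * (u x * divergence F x)) \<le> B * C" by linarith
    qed (use ibp(2) in auto)
    finally have le: "(\<integral>x. s n x \<partial>?\<mu>) \<le> B * C * measure ?\<mu> (space ?\<mu>)"
      by (simp add: mult_ac)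
    have "(\<integral>\<^sup>+x. ennreal (s n x) \<partial>?\<mu>) = ennreal (\<integral>x. s n x \<partial>?\<mu>)"
      by (rule nn_integral_eq_integral[OF s_int]) (use s_nonneg in_A in auto)
    also have "\<dots> \<le> ennreal (B * C * measure ?\<mu> (space ?\<mu>))"
      using le by (rule ennreal_leI)
    finally show ?thesis .
  qed
  have lim: "(\<lambda>n. s n x) \<longlonglongrightarrow> Du x \<bullet> F x" if "x \<in> A" for x
    unfolding s_def d_def
    using tendsto_add[OF tendsto_mult_right[OF cutoff_tendsto(1)[OF u_pos[OF that]]]
        tendsto_mult_right[OF cutoff_tendsto(2)[OF u_pos[OF that]]]]
    by simp
  have "(\<integral>\<^sup>+x. ennreal (Du x \<bullet> F x) \<partial>?\<mu>) = (\<integral>\<^sup>+x. liminf (\<lambda>n. ennreal (s n x)) \<partial>?\<mu>)"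
  proof (rule nn_integral_cong)
    fix x assume "x \<in> space ?\<mu>"
    then have "(\<lambda>n. ennreal (s n x)) \<longlonglongrightarrow> ennreal (Du x \<bullet> F x)"
      by (intro tendsto_ennrealI lim in_A)
    then show "ennreal (Du x \<bullet> F x) = liminf (\<lambda>n. ennreal (s n x))"
      by (simp add: lim_imp_Liminf)
  qed
  also have "\<dots> \<le> liminf (\<lambda>n. \<integral>\<^sup>+x. ennreal (s n x) \<partial>?\<mu>)"
    by (rule nn_integral_liminf) (use s_int in auto)
  also have "\<dots> \<le> liminf (\<lambda>n::nat. ennreal (B * C * measure ?\<mu> (space ?\<mu>)))"
    by (rule Liminf_mono) (simp add: s_bound)
  also have "\<dots> < \<infinity>"
    by (simp add: Liminf_const)
  finally have fin: "(\<integral>\<^sup>+x. ennreal (Du x \<bullet> F x) \<partial>?\<mu>) < \<infinity>" .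
  show ?thesis
  proof (rule integrableI_nonneg)
    show "(\<lambda>x. Du x \<bullet> F x) \<in> borel_measurable ?\<mu>"
      by (intro measurable_continuous_lborel_restrict continuous_intros
          C1_gradient_onD(2)[OF u] C1_field_onD(3)[OF F])
    show "AE x in ?\<mu>. 0 \<le> Du x \<bullet> F x"
      by (rule AE_I2) (use nonneg in_A in auto)
  qed (rule fin)
qed

text \<open>Let the cutoff parameter tend to 0. The error term tends to 0 pointwise, and
  \<open>\<bar>w x\<bar> \<le> c * z x\<close> together with
  \<open>z x * cutoff' \<delta> (z x) \<le> 2\<close> keeps its coefficient bounded, so a multiple
  of the integrable function \<open>norm (F x)\<close> dominates. Thus \<open>F\<close> itself may
  be unbounded near the frontier.\<close>

lemma integral_by_parts_dominated:
  fixes z w :: "'a::euclidean_space \<Rightarrow> real"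
  assumes A: "open A" "bounded A"
    and z_cont: "continuous_on (closure A) z" and z_frontier: "\<And>x. x \<in> frontier A \<Longrightarrow> z x = 0"
    and z_pos: "\<And>x. x \<in> A \<Longrightarrow> z x > 0"
    and z: "C1_gradient_on A z Dz" and z_bound: "\<And>x. x \<in> A \<Longrightarrow> norm (Dz x) \<le> Cz"
    and w: "C1_gradient_on A w Dw" and w_bound: "\<And>x. x \<in> A \<Longrightarrow> norm (Dw x) \<le> Cw"
    and w_le: "\<And>x. x \<in> A \<Longrightarrow> \<bar>w x\<bar> \<le> c * z x"
    and F: "C1_field_on A F" and F_int: "integrable (restrict_space lborel A) (\<lambda>x. norm (F x))"
    and div: "\<And>x. x \<in> A \<Longrightarrow> \<bar>divergence F x\<bar> \<le> C"
  shows "integrable (restrict_space lborel A) (\<lambda>x. Dw x \<bullet> F x)"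
    and "integrable (restrict_space lborel A) (\<lambda>x. w x * divergence F x)"
    and "(\<integral>x. Dw x \<bullet> F x \<partial>restrict_space lborel A) = - (\<integral>x. w x * divergence F x \<partial>restrict_space lborel A)"
proof -
  let ?\<mu> = "restrict_space lborel A"
  interpret finite_measure ?\<mu> by (rule finite_measure_lborel_restrict[OF A(2,1)])
  define d :: "nat \<Rightarrow> real" where "d n = inverse (Suc n)" for n
  have d_pos: "d n > 0" for n by (simp add: d_def)
  define s where "s n x = cutoff (d n) (z x) * (Dw x \<bullet> F x) + cutoff' (d n) (z x) * (w x * (Dz x \<bullet> F x))" for n x
  define r where "r n x = cutoff (d n) (z x) * (w x * divergence F x)" for n x
  have in_A: "x \<in> A" if "x \<in> space ?\<mu>" for x
    using that by (simp add: space_restrict_space)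
  have "bounded (z ` closure A)"
    using A by (intro compact_imp_bounded compact_continuous_image z_cont) (simp add: compact_closure)
  then obtain B where B: "\<And>x. x \<in> closure A \<Longrightarrow> \<bar>z x\<bar> \<le> B"
    by (auto simp: bounded_iff)
  note ibp = divergence_integral_cutoff[OF A z_cont z_frontier z_pos z w F d_pos]
  \<comment> \<open>\<open>Cw\<close> comes from the cutoff times the gradient of \<open>w\<close>,
    and \<open>2 * \<bar>c\<bar> * Cz\<close> from the error term; the absolute value is there
    because \<open>c\<close> has no prescribed sign.\<close>
  have s_dom: "norm (s n x) \<le> (Cw + 2 * \<bar>c\<bar> * Cz) * norm (F x)" if x: "x \<in> A" for n x
  proof -
    note b = cutoff_bounds[OF z_pos[OF x] d_pos[of n]]
    have 1: "\<bar>cutoff (d n) (z x) * (Dw x \<bullet> F x)\<bar> \<le> 1 * (Cw * norm (F x))"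
      unfolding abs_mult using b w_bound[OF x]
      by (intro mult_mono order_trans[OF Cauchy_Schwarz_ineq2] mult_right_mono) auto
    have "\<bar>cutoff' (d n) (z x) * w x\<bar> \<le> cutoff' (d n) (z x) * (\<bar>c\<bar> * z x)"
      unfolding abs_mult using b w_le[OF x] z_pos[OF x]
      by (intro mult_mono) (auto intro: order_trans[OF _ mult_right_mono[of c "\<bar>c\<bar>"]])
    also have "\<dots> = \<bar>c\<bar> * (z x * cutoff' (d n) (z x))" by simp
    also have "\<dots> \<le> \<bar>c\<bar> * 2" using b by (intro mult_left_mono) auto
    finally have 2: "\<bar>cutoff' (d n) (z x) * w x\<bar> \<le> 2 * \<bar>c\<bar>" by simp
    have "\<bar>(cutoff' (d n) (z x) * w x) * (Dz x \<bullet> F x)\<bar> \<le> (2 * \<bar>c\<bar>) * (Cz * norm (F x))"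
      unfolding abs_mult[of "cutoff' (d n) (z x) * w x"] using 2 z_bound[OF x]
      by (intro mult_mono order_trans[OF Cauchy_Schwarz_ineq2] mult_right_mono) auto
    then show ?thesis using 1
      unfolding s_def by (simp add: algebra_simps)
  qed
  have s_lim: "(\<lambda>n. s n x) \<longlonglongrightarrow> Dw x \<bullet> F x" if "x \<in> A" for x
    unfolding s_def d_def
    using tendsto_add[OF tendsto_mult_right[OF cutoff_tendsto(1)[OF z_pos[OF that]]]
        tendsto_mult_right[OF cutoff_tendsto(2)[OF z_pos[OF that]]]]
    by simp
  have r_lim: "(\<lambda>n. r n x) \<longlonglongrightarrow> w x * divergence F x" if "x \<in> A" for x
    unfolding r_def d_def
    using tendsto_mult_right[OF cutoff_tendsto(1)[OF z_pos[OF that]]] by simp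
  have r_dom: "norm (r n x) \<le> \<bar>c\<bar> * B * C" if x: "x \<in> A" for n x
  proof -
    note b = cutoff_bounds[OF z_pos[OF x] d_pos[of n]]
    have zB: "z x \<le> B" using B[of x] x closure_subset[of A] by auto
    have "\<bar>w x\<bar> \<le> \<bar>c\<bar> * z x"
      using w_le[OF x] z_pos[OF x] by (auto intro: order_trans[OF _ mult_right_mono[of c "\<bar>c\<bar>"]])
    also have "\<dots> \<le> \<bar>c\<bar> * B" using zB by (intro mult_left_mono) auto
    finally have "\<bar>cutoff (d n) (z x)\<bar> * (\<bar>w x\<bar> * \<bar>divergence F x\<bar>) \<le> 1 * ((\<bar>c\<bar> * B) * C)"
      using b div[OF x] by (intro mult_mono) auto
    then show ?thesis by (simp add: r_def abs_mult)
  qed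
  have meas_s: "s n \<in> borel_measurable ?\<mu>" "r n \<in> borel_measurable ?\<mu>" for n
    using ibp(1,2)[of n] unfolding s_def r_def by auto
  have meas: "(\<lambda>x. Dw x \<bullet> F x) \<in> borel_measurable ?\<mu>" "(\<lambda>x. w x * divergence F x) \<in> borel_measurable ?\<mu>"
    by (intro measurable_continuous_lborel_restrict continuous_intros
        C1_gradient_onD[OF w] C1_field_onD[OF F])+
  have AE: "AE x in ?\<mu>. P x" if "\<And>x. x \<in> A \<Longrightarrow> P x" for P
    by (rule AE_I2) (use that in_A in auto)
  have dom_int: "integrable ?\<mu> (\<lambda>x. (Cw + 2 * \<bar>c\<bar> * Cz) * norm (F x))"
    using F_int by simp
  note DCT_s = meas(1) meas_s(1) dom_int AE[OF s_lim] AE[OF s_dom]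
  have dom_int': "integrable ?\<mu> (\<lambda>x. \<bar>c\<bar> * B * C)" by simp
  note DCT_r = meas(2) meas_s(2) dom_int' AE[OF r_lim] AE[OF r_dom]
  show "integrable ?\<mu> (\<lambda>x. Dw x \<bullet> F x)"
    by (rule integrable_dominated_convergence[OF DCT_s])
  show "integrable ?\<mu> (\<lambda>x. w x * divergence F x)"
    by (rule integrable_dominated_convergence[OF DCT_r])
  have "(\<integral>x. s n x \<partial>?\<mu>) = - (\<integral>x. r n x \<partial>?\<mu>)" for n
    unfolding s_def r_def by (rule ibp(3))
  moreover have "(\<lambda>n. \<integral>x. s n x \<partial>?\<mu>) \<longlonglongrightarrow> (\<integral>x. Dw x \<bullet> F x \<partial>?\<mu>)"
    by (rule integral_dominated_convergence[OF DCT_s])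
  moreover have "(\<lambda>n. - (\<integral>x. r n x \<partial>?\<mu>)) \<longlonglongrightarrow> - (\<integral>x. w x * divergence F x \<partial>?\<mu>)"
    by (intro tendsto_minus integral_dominated_convergence[OF DCT_r])
  ultimately show "(\<integral>x. Dw x \<bullet> F x \<partial>?\<mu>) = - (\<integral>x. w x * divergence F x \<partial>?\<mu>)"
    using LIMSEQ_unique by simp
qed


section \<open>The Minkowski mean curvature operator, and what (G) and the gradient bound imply
  pointwise\<close>

text \<open>An abbreviation, so that \<open>divergence (flux u)\<close> is literally the term in
  \<open>positive_classical_solution\<close>.\<close>

abbreviation flux :: "('a::euclidean_space \<Rightarrow> real) \<Rightarrow> 'a \<Rightarrow> 'a" where
  "flux u y \<equiv> grad u y /\<^sub>R sqrt (1 - (norm (grad u y))\<^sup>2)"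

lemma inverse_sqrt_derivative:
  assumes "t > 0"
  shows "((\<lambda>t. inverse (sqrt t)) has_real_derivative - (inverse (2 * sqrt t ^ 3))) (at t)"
proof -
  have "((\<lambda>t. inverse (sqrt t)) has_real_derivative
      - (inverse (sqrt t) * (inverse (sqrt t) / 2) * inverse (sqrt t))) (at t)"
    using assms by (intro DERIV_inverse' DERIV_real_sqrt) auto
  moreover have "inverse r * (inverse r / 2) * inverse r = inverse (2 * r ^ 3)" for r :: real
    by (simp add: power3_eq_cube)
  ultimately show ?thesis by simp
qed

lemma mean_curvature_derivative:
  fixes p :: "'a::euclidean_space"
  assumes "norm p < 1"
  defines "s \<equiv> sqrt (1 - (norm p)\<^sup>2)"
  shows "((\<lambda>p. p /\<^sub>R sqrt (1 - (norm p)\<^sup>2)) has_derivative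
    (\<lambda>h. h /\<^sub>R s + ((p \<bullet> h) / s ^ 3) *\<^sub>R p)) (at p)"
proof -
  have pos: "1 - p \<bullet> p > 0"
    using assms(1) by (simp add: norm_lt_square)
  then have s: "s > 0" "s * s = 1 - p \<bullet> p"
    by (auto simp: s_def power2_norm_eq_inner)
  have "((\<lambda>t. inverse (sqrt t)) has_real_derivative - (inverse (2 * s ^ 3))) (at (1 - p \<bullet> p))"
    using inverse_sqrt_derivative[OF pos] by (simp add: s_def power2_norm_eq_inner)
  moreover have "((\<lambda>p. 1 - p \<bullet> p) has_derivative (\<lambda>h. - 2 * (p \<bullet> h))) (at p)"
    by (auto intro!: derivative_eq_intros simp: inner_commute)
  ultimately have "((\<lambda>p. inverse (sqrt (1 - p \<bullet> p))) has_derivative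
      (\<lambda>h. - (inverse (2 * s ^ 3)) * (- 2 * (p \<bullet> h)))) (at p)"
    using has_derivative_compose[of "\<lambda>p. 1 - p \<bullet> p"] unfolding has_field_derivative_def by blast
  from has_derivative_scaleR[OF this has_derivative_ident]
  have "((\<lambda>p. inverse (sqrt (1 - p \<bullet> p)) *\<^sub>R p) has_derivative
      (\<lambda>h. inverse (sqrt (1 - p \<bullet> p)) *\<^sub>R h + (- (inverse (2 * s ^ 3)) * (- 2 * (p \<bullet> h))) *\<^sub>R p)) (at p)" .
  moreover have "- inverse (2 * s ^ 3) * (- 2 * (p \<bullet> h)) = (p \<bullet> h) / s ^ 3" for h
    by (simp add: inverse_eq_divide)
  ultimately show ?thesis
    unfolding s_def power2_norm_eq_inner by (simp only:)
qed

lemma grad_has_derivative: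
  assumes "f differentiable (at x)"
  shows "(f has_derivative (\<lambda>h. grad f x \<bullet> h)) (at x)"
proof -
  have f: "(f has_derivative frechet_derivative f (at x)) (at x)"
    using assms by (simp add: frechet_derivative_works)
  then interpret linear "frechet_derivative f (at x)"
    by (rule has_derivative_linear)
  have "frechet_derivative f (at x) h = grad f x \<bullet> h" for h
  proof -
    have "frechet_derivative f (at x) h = frechet_derivative f (at x) (\<Sum>b\<in>Basis. (h \<bullet> b) *\<^sub>R b)"
      by (simp add: euclidean_representation)
    also have "\<dots> = grad f x \<bullet> h"
      by (simp add: sum scaleR grad_def partial_deriv_def inner_sum_left inner_commute[of h] mult.commute)
    finally show ?thesis .
  qed
  then have "frechet_derivative f (at x) = (\<lambda>h. grad f x \<bullet> h)" by (rule ext)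
  with f show ?thesis by simp
qed

lemma Ck_on_2_grad:
  assumes "Ck_on 2 A u"
  shows "C1_gradient_on A u (grad u)"
    and "x \<in> A \<Longrightarrow> (grad u has_derivative
          (\<lambda>h. \<Sum>c\<in>Basis. frechet_derivative (partial_deriv c u) (at x) h *\<^sub>R c)) (at x)"
proof -
  have u: "\<And>x. x \<in> A \<Longrightarrow> u differentiable (at x)"
    and u': "\<And>x c. x \<in> A \<Longrightarrow> c \<in> Basis \<Longrightarrow> partial_deriv c u differentiable (at x)"
    using assms by (auto simp: numeral_2_eq_2)
  show deriv: "(grad u has_derivative
        (\<lambda>h. \<Sum>c\<in>Basis. frechet_derivative (partial_deriv c u) (at x) h *\<^sub>R c)) (at x)" if "x \<in> A" for x
    unfolding grad_def[abs_def]
    by (intro has_derivative_sum has_derivative_scaleR_left)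
      (use u'[OF that] in \<open>simp add: frechet_derivative_works\<close>)
  show "C1_gradient_on A u (grad u)"
    unfolding C1_gradient_on_def
    using u deriv by (auto intro: grad_has_derivative continuous_at_imp_continuous_on has_derivative_continuous)
qed

lemma flux_C1_field:
  assumes u: "Ck_on 2 A u" and grad: "\<And>x. x \<in> A \<Longrightarrow> norm (grad u x) < 1"
  shows "C1_field_on A (flux u)"
proof -
  define H where "H x h = (\<Sum>c\<in>Basis. frechet_derivative (partial_deriv c u) (at x) h *\<^sub>R c)" for x h
  define s where "s x = sqrt (1 - (norm (grad u x))\<^sup>2)" for x
  have deriv: "(flux u has_derivative (\<lambda>h. H x h /\<^sub>R s x + ((grad u x \<bullet> H x h) / s x ^ 3) *\<^sub>R grad u x)) (at x)"
    if "x \<in> A" for x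
    using has_derivative_compose[OF Ck_on_2_grad(2)[OF u that] mean_curvature_derivative[OF grad[OF that]]]
    unfolding H_def s_def .
  have s_pos: "s x > 0" if "x \<in> A" for x
    using grad[OF that] by (simp add: s_def abs_square_less_1)
  have H_cont: "continuous_on A (\<lambda>x. H x b)" if "b \<in> Basis" for b
    unfolding H_def using u that
    by (intro continuous_intros) (simp add: numeral_2_eq_2 partial_deriv_def[abs_def])
  have grad_cont: "continuous_on A (grad u)"
    using C1_gradient_onD(2)[OF Ck_on_2_grad(1)[OF u]] .
  have s_cont: "continuous_on A s"
    unfolding s_def by (intro continuous_intros grad_cont)
  show ?thesis
    unfolding C1_field_on_def
  proof (intro conjI ballI)
    show "flux u differentiable (at x)" if "x \<in> A" for x
      using deriv[OF that] by (rule differentiableI)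
    fix b :: 'a assume b: "b \<in> Basis"
    have "continuous_on A (\<lambda>x. H x b /\<^sub>R s x + ((grad u x \<bullet> H x b) / s x ^ 3) *\<^sub>R grad u x)"
      using s_pos by (intro continuous_intros H_cont[OF b] s_cont grad_cont) (auto simp: less_imp_neq[THEN not_sym])
    then show "continuous_on A (\<lambda>x. frechet_derivative (flux u) (at x) b)"
      by (rule continuous_on_eq) (simp add: frechet_derivative_at[OF deriv, symmetric])
  qed
qed

text \<open>At \<open>t = c\<^sup>2\<close> the derivative of the concave function is
  \<open>g c / (2 * c)\<close>, and derivatives of concave functions decrease. This is derived from
  the tangent inequalities at \<open>a\<^sup>2\<close> and \<open>b\<^sup>2\<close>;
  \<open>b < M\<close> makes both points interior.\<close>

lemma concave_quotient_decreasing: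
  fixes g :: "real \<Rightarrow> real"
  assumes conc: "concave_on {0..M\<^sup>2} (\<lambda>t. integral {0..sqrt t} g)"
    and g: "continuous_on {0..M} g" and ab: "0 < a" "a \<le> b" "b < M"
  shows "g b / b \<le> g a / a"
proof -
  define \<psi> where "\<psi> t = - integral {0..sqrt t} g" for t
  have conv: "convex_on {0..M\<^sup>2} \<psi>"
    using conc by (simp add: \<psi>_def[abs_def] concave_on_def)
  have sq: "a\<^sup>2 < M\<^sup>2" "b\<^sup>2 < M\<^sup>2" "a\<^sup>2 \<le> b\<^sup>2"
    using ab by (auto intro!: power_strict_mono power_mono)
  have tangent: "\<psi> x - \<psi> (c\<^sup>2) \<ge> (- (g c / c) / 2) * (x - c\<^sup>2)" if c: "0 < c" "c < M" and x: "x \<in> {0..M\<^sup>2}" for c x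
  proof (rule convex_on_imp_above_tangent[OF conv])
    have cM: "c\<^sup>2 < M\<^sup>2" using c by (auto intro!: power_strict_mono)
    show "connected {0..M\<^sup>2}" by simp
    show "c\<^sup>2 \<in> interior {0..M\<^sup>2}" using c cM by simp
    have "((\<lambda>x. integral {0..x} g) has_real_derivative g c) (at c)"
      using integral_has_real_derivative[OF g, of c] c at_within_Icc_at[of 0 c M] by simp
    moreover have "(sqrt has_real_derivative 1 / (2 * c)) (at (c\<^sup>2))"
      using c by (auto intro!: derivative_eq_intros simp: divide_simps)
    ultimately have "((\<lambda>t. integral {0..sqrt t} g) has_real_derivative g c * (1 / (2 * c))) (at (c\<^sup>2))"
      using DERIV_chain2[of "\<lambda>x. integral {0..x} g" "g c" sqrt "c\<^sup>2" "1 / (2 * c)" UNIV] c by simp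
    from DERIV_minus[OF this]
    show "(\<psi> has_real_derivative - (g c / c) / 2) (at (c\<^sup>2) within {0..M\<^sup>2})"
      unfolding \<psi>_def by (auto intro: DERIV_subset simp: mult.commute[of c 2])
  qed (use x in auto)
  have "\<psi> (b\<^sup>2) - \<psi> (a\<^sup>2) \<ge> (- (g a / a) / 2) * (b\<^sup>2 - a\<^sup>2)"
    "\<psi> (a\<^sup>2) - \<psi> (b\<^sup>2) \<ge> (- (g b / b) / 2) * (a\<^sup>2 - b\<^sup>2)"
    using tangent[of a "b\<^sup>2"] tangent[of b "a\<^sup>2"] ab sq by auto
  \<comment> \<open>Adding the two tangent inequalities cancels the function values and leaves only
    the slopes.\<close>
  moreover have "(\<beta> - \<alpha>) * (t - s) \<le> 0"
    if "y - x \<ge> (- \<alpha> / 2) * (t - s)" "x - y \<ge> (- \<beta> / 2) * (s - t)" for \<alpha> \<beta> s t x y :: real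
    using add_mono[OF that] by (simp add: field_simps)
  ultimately have "(g b / b - g a / a) * (b\<^sup>2 - a\<^sup>2) \<le> 0" by blast
  moreover have "a < b \<Longrightarrow> a\<^sup>2 < b\<^sup>2"
    using ab by (auto intro!: power_strict_mono)
  ultimately show ?thesis
    using ab by (cases "a = b") (auto simp: mult_le_0_iff)
qed

text \<open>Two opposite rays from \<open>x\<close> first meet the frontier at distances
  \<open>d\<close> and \<open>e\<close>. By the mean value theorem along each ray \<open>u x\<close>
  is less than both, and \<open>d + e\<close> is the distance of two points of the closure.\<close>

lemma spacelike_less_half_diameter:
  fixes u :: "'a::euclidean_space \<Rightarrow> real"
  assumes A: "open A" "bounded A" and u_cont: "continuous_on (closure A) u"
    and u_frontier: "\<And>x. x \<in> frontier A \<Longrightarrow> u x = 0"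
    and u: "C1_gradient_on A u D" and D: "\<And>x. x \<in> A \<Longrightarrow> norm (D x) < 1"
    and x: "x \<in> A"
  shows "u x < diameter (closure A) / 2"
proof -
  have ray: "\<exists>d. 0 < d \<and> x + d *\<^sub>R l \<in> frontier A \<and> u x < d" if l: "norm l = 1" for l :: 'a
  proof -
    have "l \<noteq> 0" "x \<in> interior A" using l x A by (auto simp: interior_open)
    with ray_to_frontier[OF A(2)] obtain d where d: "0 < d" "x + d *\<^sub>R l \<in> frontier A"
        and seg: "\<And>e. 0 \<le> e \<Longrightarrow> e < d \<Longrightarrow> x + e *\<^sub>R l \<in> interior A"
      by blast
    have seg': "x + e *\<^sub>R l \<in> A" if "0 \<le> e" "e < d" for e
      using seg[OF that] interior_subset by auto
    have in_closure: "x + e *\<^sub>R l \<in> closure A" if "0 \<le> e" "e \<le> d" for e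
      using seg'[of e] d(2) that closure_subset[of A]
      by (cases "e = d") (auto simp: frontier_def)
    obtain e where e: "0 < e" "e < d"
      and mv: "u (x + d *\<^sub>R l) - u (x + 0 *\<^sub>R l) = D (x + e *\<^sub>R l) \<bullet> ((d - 0) *\<^sub>R l)"
    proof (rule mvt[where f = "\<lambda>e. u (x + e *\<^sub>R l)" and f' = "\<lambda>e h. D (x + e *\<^sub>R l) \<bullet> (h *\<^sub>R l)"])
      show "0 < d" by fact
      show "continuous_on {0..d} (\<lambda>e. u (x + e *\<^sub>R l))"
        by (rule continuous_on_compose2[OF u_cont]) (use in_closure in \<open>auto intro!: continuous_intros\<close>)
      fix e assume e: "0 < e" "e < d"
      show "((\<lambda>e. u (x + e *\<^sub>R l)) has_derivative (\<lambda>h. D (x + e *\<^sub>R l) \<bullet> (h *\<^sub>R l))) (at e)"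
        by (rule has_derivative_compose[where f = "\<lambda>e. x + e *\<^sub>R l" and g = u and x = e, OF _ C1_gradient_onD(1)[OF u seg'[of e]]])
          (use e in \<open>auto intro!: derivative_eq_intros\<close>)
    qed
    have "\<bar>D (x + e *\<^sub>R l) \<bullet> l\<bar> < 1"
      using Cauchy_Schwarz_ineq2[of "D (x + e *\<^sub>R l)" l] D[OF seg'[of e]] e l by auto
    then have "- (D (x + e *\<^sub>R l) \<bullet> l) < 1"
      by linarith
    then have "d * - (D (x + e *\<^sub>R l) \<bullet> l) < d * 1"
      using d(1) by (rule mult_strict_left_mono)
    then have "u x < d"
      using mv u_frontier[OF d(2)] by simp
    then show ?thesis using d by auto
  qed
  obtain b :: 'a where b: "b \<in> Basis" using nonempty_Basis by blast
  obtain d e where d: "0 < d" "x + d *\<^sub>R b \<in> frontier A" "u x < d"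
    and e: "0 < e" "x + e *\<^sub>R (- b) \<in> frontier A" "u x < e"
    using ray[of b] ray[of "- b"] b by auto
  have "dist (x + d *\<^sub>R b) (x + e *\<^sub>R (- b)) \<le> diameter (closure A)"
    using d(2) e(2) A by (intro diameter_bounded_bound) (auto simp: frontier_def)
  moreover have "dist (x + d *\<^sub>R b) (x + e *\<^sub>R (- b)) = d + e"
    using b d(1) e(1) by (simp add: dist_norm scaleR_add_left[symmetric])
  ultimately show ?thesis using d e by linarith
qed


section \<open>Picone type inequalities and the corresponding test functions\<close>

text \<open>Here \<open>p\<close>, \<open>q\<close> stand for the gradients of \<open>u\<close>,
  \<open>v\<close>, the weights \<open>a\<close>, \<open>b\<close> for the factors in their fluxes,
  and \<open>r\<close> for the quotient of the shifted functions. The difference of the two sides is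
  a weighted sum of the squares of \<open>norm (r *\<^sub>R p - q)\<close> and
  \<open>norm ((1 / r) *\<^sub>R q - p)\<close>. The lower bound is free of \<open>r\<close>, hence
  of the shift.\<close>

lemma picone_lower_bound:
  fixes p q :: "'a::real_inner"
  assumes "a \<ge> 0" "b \<ge> 0" "r > 0"
  shows "(a - b) * ((norm p)\<^sup>2 - (norm q)\<^sup>2)
    \<le> a * ((p - (2 * r) *\<^sub>R q + r\<^sup>2 *\<^sub>R p) \<bullet> p) + b * ((q - (2 / r) *\<^sub>R p + (1 / r)\<^sup>2 *\<^sub>R q) \<bullet> q)"
proof -
  have "a * ((p - (2 * r) *\<^sub>R q + r\<^sup>2 *\<^sub>R p) \<bullet> p) + b * ((q - (2 / r) *\<^sub>R p + (1 / r)\<^sup>2 *\<^sub>R q) \<bullet> q)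
      - (a - b) * ((norm p)\<^sup>2 - (norm q)\<^sup>2)
      = a * (norm (r *\<^sub>R p - q))\<^sup>2 + b * (norm ((1 / r) *\<^sub>R q - p))\<^sup>2"
    unfolding power2_norm_eq_inner
    by (simp add: inner_diff inner_add inner_commute[of q p] algebra_simps power2_eq_square)
  moreover have "0 \<le> a * (norm (r *\<^sub>R p - q))\<^sup>2 + b * (norm ((1 / r) *\<^sub>R q - p))\<^sup>2"
    using assms by simp
  ultimately show ?thesis by linarith
qed

text \<open>For equal norms the previous bound degenerates to 0. With \<open>k = r + 1 / r\<close>
  the right side becomes \<open>(a * k) * (k * (p \<bullet> p) - 2 * (p \<bullet> q))\<close>; since
  \<open>k \<ge> 2\<close>, the second factor is at least the square of \<open>norm (p - q)\<close>,
  again with no trace of \<open>r\<close>.\<close>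

lemma picone_lower_bound_eq_norm:
  fixes p q :: "'a::real_inner"
  assumes "a \<ge> 1" "r > 0" and eq: "norm p = norm q"
  shows "2 * (norm (p - q))\<^sup>2
    \<le> a * ((p - (2 * r) *\<^sub>R q + r\<^sup>2 *\<^sub>R p) \<bullet> p) + a * ((q - (2 / r) *\<^sub>R p + (1 / r)\<^sup>2 *\<^sub>R q) \<bullet> q)"
proof -
  define k where "k = r + 1 / r"
  have "k - 2 = (r - 1)\<^sup>2 / r"
    using assms by (simp add: k_def field_simps power2_eq_square)
  then have k: "k \<ge> 2"
    using assms by (metis diff_ge_0_iff_ge divide_nonneg_pos zero_le_power2)
  have k2: "k\<^sup>2 = r\<^sup>2 + 2 + (1 / r)\<^sup>2"
    using assms by (simp add: k_def power2_eq_square field_simps)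
  have nn: "q \<bullet> q = p \<bullet> p"
    using eq by (simp add: norm_eq)
  have d: "(norm (p - q))\<^sup>2 = 2 * (p \<bullet> p) - 2 * (p \<bullet> q)"
    by (simp add: power2_norm_eq_inner inner_diff inner_commute[of q p] nn)
  have "2 * (p \<bullet> p) \<le> k * (p \<bullet> p)"
    using k by (intro mult_right_mono) auto
  then have "(norm (p - q))\<^sup>2 \<le> k * (p \<bullet> p) - 2 * (p \<bullet> q)"
    using d by linarith
  moreover have "2 \<le> a * k"
    using mult_mono[of 1 a 2 k] assms k by simp
  ultimately have "2 * (norm (p - q))\<^sup>2 \<le> (a * k) * (k * (p \<bullet> p) - 2 * (p \<bullet> q))"
    by (intro mult_mono) auto
  also have "\<dots> = a * (k\<^sup>2 * (p \<bullet> p) - 2 * k * (p \<bullet> q))"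
    by (simp add: algebra_simps power2_eq_square)
  also have "\<dots> = a * ((p - (2 * r) *\<^sub>R q + r\<^sup>2 *\<^sub>R p) \<bullet> p) + a * ((q - (2 / r) *\<^sub>R p + (1 / r)\<^sup>2 *\<^sub>R q) \<bullet> q)"
    unfolding k2 by (simp add: k_def inner_diff inner_add inner_commute[of q p] nn algebra_simps)
  finally show ?thesis .
qed

text \<open>In place of the equation only boundedness of the divergence is kept, so that the
  integral identities do not mention \<open>g\<close>.\<close>

locale spacelike_function =
  fixes A :: "'a::euclidean_space set" and u :: "'a \<Rightarrow> real"
  assumes open_A: "open A" and bounded_A: "bounded A"
    and cont: "continuous_on (closure A) u"
    and frontier_0: "\<And>x. x \<in> frontier A \<Longrightarrow> u x = 0"
    and pos: "\<And>x. x \<in> A \<Longrightarrow> u x > 0"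
    and C2: "Ck_on 2 A u"
    and spacelike: "\<And>x. x \<in> A \<Longrightarrow> norm (grad u x) < 1"
    and bounded_div: "bounded (divergence (flux u) ` A)"
begin

lemma C1_grad: "C1_gradient_on A u (grad u)"
  by (rule Ck_on_2_grad[OF C2])

lemma C1_flux: "C1_field_on A (flux u)"
  by (rule flux_C1_field[OF C2 spacelike])

lemma sqrt_pos: "x \<in> A \<Longrightarrow> 0 < sqrt (1 - (norm (grad u x))\<^sup>2)"
  using spacelike[of x] by (simp add: abs_square_less_1)

lemma inverse_sqrt_ge_1: "x \<in> A \<Longrightarrow> 1 \<le> inverse (sqrt (1 - (norm (grad u x))\<^sup>2))"
  using sqrt_pos[of x] by (intro one_le_inverse) auto

lemma norm_flux_integrable: "integrable (restrict_space lborel A) (\<lambda>x. norm (flux u x))"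
proof -
  let ?\<mu> = "restrict_space lborel A"
  interpret finite_measure ?\<mu> by (rule finite_measure_lborel_restrict[OF bounded_A open_A])
  obtain C where C: "\<And>x. x \<in> A \<Longrightarrow> \<bar>divergence (flux u) x\<bar> \<le> C"
    using bounded_div by (auto simp: bounded_iff)
  have "integrable ?\<mu> (\<lambda>x. grad u x \<bullet> flux u x)"
    by (rule integrable_gradient_flux[OF open_A bounded_A cont frontier_0 pos C1_grad C1_flux _ C])
      (use sqrt_pos in \<open>auto simp: less_imp_le\<close>)
  then have "integrable ?\<mu> (\<lambda>x. 1 + grad u x \<bullet> flux u x)"
    by simp
  then show ?thesis
  proof (rule Bochner_Integration.integrable_bound)
    show "(\<lambda>x. norm (flux u x)) \<in> borel_measurable ?\<mu>"
      using measurable_continuous_lborel_restrict[OF continuous_on_norm[OF C1_field_onD(3)[OF C1_flux]]] .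
    show "AE x in ?\<mu>. norm (norm (flux u x)) \<le> norm (1 + grad u x \<bullet> flux u x)"
    proof (rule AE_I2)
      fix x assume "x \<in> space ?\<mu>"
      then have x: "x \<in> A" by (simp add: space_restrict_space)
      define n where "n = norm (grad u x)"
      define s where "s = sqrt (1 - n\<^sup>2)"
      have s: "0 < s" "s \<le> 1" "s * s = 1 - n\<^sup>2"
        using sqrt_pos[OF x] spacelike[OF x] by (auto simp: s_def n_def abs_square_le_1)
      have "norm (flux u x) = n / s"
        using s by (simp add: s_def[symmetric] n_def[symmetric] divide_inverse mult.commute)
      also have "\<dots> \<le> 1 / s"
        using s spacelike[OF x] by (intro divide_right_mono) (auto simp: n_def)
      \<comment> \<open>From \<open>s * s = 1 - n\<^sup>2\<close>. It bounds the flux by 1 plus its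
        product with the gradient, which is already known to be integrable.\<close>
      also have "\<dots> = s + n\<^sup>2 / s"
        using s by (simp add: field_simps)
      also have "\<dots> \<le> 1 + n\<^sup>2 / s" using s by simp
      also have "n\<^sup>2 / s = grad u x \<bullet> flux u x"
        by (simp add: s_def n_def power2_norm_eq_inner divide_inverse mult.commute)
      finally show "norm (norm (flux u x)) \<le> norm (1 + grad u x \<bullet> flux u x)"
        by simp
    qed
  qed
qed

text \<open>\<open>D\<close> is the gradient of the test function \<open>w\<close>. The comparison
  function for the cutoff is \<open>u x + v x\<close> and not \<open>u x\<close>, because nothing is
  known about the ratio of \<open>u\<close> and \<open>v\<close> near the frontier.\<close>

lemma picone_test:
  assumes v: "spacelike_function A v" and \<epsilon>: "\<epsilon> > 0"
  defines "w \<equiv> \<lambda>x. ((u x + \<epsilon>)\<^sup>2 - (v x + \<epsilon>)\<^sup>2) / (u x + \<epsilon>)"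
    and "r \<equiv> \<lambda>x. (v x + \<epsilon>) / (u x + \<epsilon>)"
  defines "D \<equiv> \<lambda>x. grad u x - (2 * r x) *\<^sub>R grad v x + (r x)\<^sup>2 *\<^sub>R grad u x"
  shows "integrable (restrict_space lborel A) (\<lambda>x. D x \<bullet> flux u x)"
    and "integrable (restrict_space lborel A) (\<lambda>x. w x * divergence (flux u) x)"
    and "(\<integral>x. D x \<bullet> flux u x \<partial>restrict_space lborel A)
      = - (\<integral>x. w x * divergence (flux u) x \<partial>restrict_space lborel A)"
proof -
  interpret v: spacelike_function A v by fact
  obtain C where C: "\<And>x. x \<in> A \<Longrightarrow> \<bar>divergence (flux u) x\<bar> \<le> C"
    using bounded_div by (auto simp: bounded_iff)
  have "bounded (v ` closure A)"
    using bounded_A by (intro compact_imp_bounded compact_continuous_image v.cont) (simp add: compact_closure)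
  then obtain B where B: "\<And>x. x \<in> closure A \<Longrightarrow> \<bar>v x\<bar> \<le> B"
    by (auto simp: bounded_iff)
  \<comment> \<open>The shift makes the denominator exceed \<open>\<epsilon>\<close>, so the ratio
    \<open>r\<close> stays bounded; bounds for \<open>D\<close> and \<open>w\<close> follow. They
    depend on \<open>\<epsilon>\<close>, which is fixed here.\<close>
  define R where "R = (B + \<epsilon>) / \<epsilon>"
  have r: "0 < r x" "r x \<le> R" if x: "x \<in> A" for x
  proof -
    have "v x \<le> B" using B[of x] x closure_subset[of A] by auto
    then show "0 < r x" "r x \<le> R"
      using pos[OF x] v.pos[OF x] \<epsilon> unfolding r_def R_def
      by (auto intro!: frac_le)
  qed
  have u_nz: "u x + \<epsilon> > 0" if "x \<in> A" for x
    using pos[OF that] \<epsilon> by simp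
  have z: "C1_gradient_on A (\<lambda>x. u x + v x) (\<lambda>x. grad u x + grad v x)"
    unfolding C1_gradient_on_def inner_add_left
    using C1_gradient_onD[OF C1_grad] C1_gradient_onD[OF v.C1_grad]
    by (auto intro!: has_derivative_add continuous_intros)
  have z_bound: "norm (grad u x + grad v x) \<le> 2" if "x \<in> A" for x
    using norm_triangle_ineq[of "grad u x" "grad v x"] spacelike[OF that] v.spacelike[OF that] by linarith
  have w: "C1_gradient_on A w D"
    unfolding C1_gradient_on_def
  proof (intro conjI ballI)
    fix x assume x: "x \<in> A"
    note du = C1_gradient_onD(1)[OF C1_grad x] and dv = C1_gradient_onD(1)[OF v.C1_grad x]
    define U V where "U = u x + \<epsilon>" and "V = v x + \<epsilon>"
    have U: "U \<noteq> 0" using u_nz[OF x] by (simp add: U_def)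
    have num: "((\<lambda>y. (u y + \<epsilon>)\<^sup>2 - (v y + \<epsilon>)\<^sup>2) has_derivative
        (\<lambda>h. 2 * U * (grad u x \<bullet> h) - 2 * V * (grad v x \<bullet> h))) (at x)"
      by (auto intro!: derivative_eq_intros du dv simp: U_def V_def algebra_simps)
    have den: "((\<lambda>y. u y + \<epsilon>) has_derivative (\<lambda>h. grad u x \<bullet> h)) (at x)"
      by (auto intro!: derivative_eq_intros du)
    have "- (U\<^sup>2 - V\<^sup>2) * (inverse U * s * inverse U) + (2 * U * s - 2 * V * t) / U
        = s - 2 * (V / U) * t + (V / U)\<^sup>2 * s" for s t
      using U by (simp add: field_simps power2_eq_square)
    then have "D x \<bullet> h = - (U\<^sup>2 - V\<^sup>2) * (inverse U * (grad u x \<bullet> h) * inverse U)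
        + (2 * U * (grad u x \<bullet> h) - 2 * V * (grad v x \<bullet> h)) / U" for h
      by (simp add: D_def r_def U_def V_def inner_add_left inner_diff_left)
    then show "(w has_derivative (\<lambda>h. D x \<bullet> h)) (at x)"
      using Deriv.has_derivative_divide[OF num den] U unfolding w_def by (simp add: U_def V_def)
  next
    show "continuous_on A D"
      unfolding D_def r_def using u_nz
      by (intro continuous_intros C1_gradient_onD[OF C1_grad] C1_gradient_onD[OF v.C1_grad])
        (auto simp: less_imp_neq[THEN not_sym])
  qed
  have D_bound: "norm (D x) \<le> 1 + 2 * R + R\<^sup>2" if x: "x \<in> A" for x
  proof -
    have "norm (D x) \<le> norm (grad u x) + norm ((2 * r x) *\<^sub>R grad v x) + norm ((r x)\<^sup>2 *\<^sub>R grad u x)"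
      unfolding D_def by (meson add_mono norm_triangle_ineq norm_triangle_ineq4 order_refl order_trans)
    also have "\<dots> = norm (grad u x) + (2 * r x) * norm (grad v x) + (r x)\<^sup>2 * norm (grad u x)"
      using r[OF x] by simp
    also have "\<dots> \<le> 1 + (2 * R) * 1 + R\<^sup>2 * 1"
      using r[OF x] spacelike[OF x] v.spacelike[OF x]
      by (intro add_mono mult_mono power_mono) auto
    finally show ?thesis by simp
  qed
  have w_le: "\<bar>w x\<bar> \<le> (1 + R) * (u x + v x)" if x: "x \<in> A" for x
  proof -
    \<comment> \<open>The shift cancels in the difference of squares, so \<open>w\<close> still
      vanishes on the frontier at the rate of \<open>u x + v x\<close>.\<close>
    have "w x = (u x - v x) * (1 + r x)"
      using u_nz[OF x] by (simp add: w_def r_def field_simps power2_eq_square)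
    then have "\<bar>w x\<bar> = \<bar>u x - v x\<bar> * (1 + r x)"
      using r[OF x] by (simp add: abs_mult)
    also have "\<dots> \<le> (u x + v x) * (1 + R)"
      using r[OF x] pos[OF x] v.pos[OF x] by (intro mult_mono) auto
    finally show ?thesis by (simp add: mult.commute)
  qed
  have zc: "continuous_on (closure A) (\<lambda>x. u x + v x)"
    by (intro continuous_intros cont v.cont)
  have zf: "u x + v x = 0" if "x \<in> frontier A" for x
    using frontier_0[OF that] v.frontier_0[OF that] by simp
  have zp: "u x + v x > 0" if "x \<in> A" for x
    using pos[OF that] v.pos[OF that] by simp
  note * = integral_by_parts_dominated[OF open_A bounded_A zc zf zp z z_bound w D_bound w_le
      C1_flux norm_flux_integrable C]
  show "integrable (restrict_space lborel A) (\<lambda>x. D x \<bullet> flux u x)" by (rule *(1))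
  show "integrable (restrict_space lborel A) (\<lambda>x. w x * divergence (flux u) x)" by (rule *(2))
  show "(\<integral>x. D x \<bullet> flux u x \<partial>restrict_space lborel A)
      = - (\<integral>x. w x * divergence (flux u) x \<partial>restrict_space lborel A)" by (rule *(3))
qed

end


section \<open>Letting the shift tend to 0, and uniqueness\<close>

lemma AE_zero_imp_zero_on_open:
  fixes f :: "'a::euclidean_space \<Rightarrow> real"
  assumes A: "open A" and f: "continuous_on A f"
    and AE: "AE x in restrict_space lborel A. f x = 0" and x: "x \<in> A"
  shows "f x = 0"
proof (rule ccontr)
  assume "f x \<noteq> 0"
  define S where "S = A \<inter> f -` (- {0})"
  have S: "open S" "x \<in> S"
    using continuous_open_preimage[OF f A] x \<open>f x \<noteq> 0\<close> by (auto simp: S_def)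
  have "AE x in lborel. x \<in> A \<longrightarrow> f x = 0"
    using AE A by (subst (asm) AE_restrict_space_iff) auto
  then have "AE x in lborel. x \<notin> S"
    by (rule eventually_mono) (auto simp: S_def)
  then have "S \<in> null_sets lborel"
    using S by (subst (asm) AE_iff_null_sets[symmetric]) auto
  then have "negligible S"
    by (simp add: negligible_iff_null_sets null_sets_completionI)
  then show False
    using open_not_negligible[OF S(1)] S(2) by auto
qed

lemma inverse_sqrt_monotone:
  fixes s t :: real
  assumes "0 \<le> s" "s < 1" "0 \<le> t" "t < 1"
  defines "a \<equiv> \<lambda>s::real. inverse (sqrt (1 - s\<^sup>2))"
  shows "0 \<le> (a s - a t) * (s\<^sup>2 - t\<^sup>2)" and "(a s - a t) * (s\<^sup>2 - t\<^sup>2) = 0 \<Longrightarrow> s = t"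
proof -
  have less: "a s < a t" "s\<^sup>2 < t\<^sup>2" if "0 \<le> s" "s < t" "t < 1" for s t
  proof -
    show st: "s\<^sup>2 < t\<^sup>2" using that by (intro power_strict_mono) auto
    have "0 < 1 - t\<^sup>2" using that by (simp add: abs_square_less_1)
    then show "a s < a t" using st unfolding a_def by (intro less_imp_inverse_less) auto
  qed
  consider "s < t" | "t < s" | "s = t" by linarith
  then have "s = t \<or> 0 < (a s - a t) * (s\<^sup>2 - t\<^sup>2)"
    by cases (use less[of s t] less[of t s] assms in \<open>auto simp: mult_neg_neg\<close>)
  then show "0 \<le> (a s - a t) * (s\<^sup>2 - t\<^sup>2)" and "(a s - a t) * (s\<^sup>2 - t\<^sup>2) = 0 \<Longrightarrow> s = t"
    by auto
qed

text \<open>The divergences play the role of the negated reaction terms: the upper bounds with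
  \<open>K\<close> express \<open>g x t \<ge> - K * t\<close> along the solutions, and the sign
  condition is the monotonicity of \<open>g x t / t\<close>.\<close>

lemma spacelike_unique:
  fixes u v :: "'a::euclidean_space \<Rightarrow> real"
  assumes u: "spacelike_function A u" and v: "spacelike_function A v"
    and conn: "connected A" and ne: "A \<noteq> {}"
    and K: "K \<ge> 0"
    and u_upper: "\<And>x. x \<in> A \<Longrightarrow> divergence (flux u) x \<le> K * u x"
    and v_upper: "\<And>x. x \<in> A \<Longrightarrow> divergence (flux v) x \<le> K * v x"
    and mono: "\<And>x. x \<in> A \<Longrightarrow>
      0 \<le> ((u x)\<^sup>2 - (v x)\<^sup>2) * (divergence (flux u) x / u x - divergence (flux v) x / v x)"
    and x: "x \<in> closure A"
  shows "u x = v x"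
proof -
  interpret u: spacelike_function A u by fact
  interpret v: spacelike_function A v by fact
  let ?\<mu> = "restrict_space lborel A"
  interpret finite_measure ?\<mu> by (rule finite_measure_lborel_restrict[OF u.bounded_A u.open_A])
  have in_A: "x \<in> A" if "x \<in> space ?\<mu>" for x
    using that by (simp add: space_restrict_space)
  have AE: "AE x in ?\<mu>. P x" if "\<And>x. x \<in> A \<Longrightarrow> P x" for P
    by (rule AE_I2) (use that in_A in auto)
  have bounds: "\<exists>B C. \<forall>x\<in>A. \<bar>f x\<bar> \<le> B \<and> \<bar>divergence (flux f) x\<bar> \<le> C" if "spacelike_function A f" for f
  proof -
    interpret f: spacelike_function A f by fact
    have "bounded (f ` closure A)"
      using f.bounded_A by (intro compact_imp_bounded compact_continuous_image f.cont) (simp add: compact_closure)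
    then obtain B where B: "\<And>x. x \<in> closure A \<Longrightarrow> \<bar>f x\<bar> \<le> B"
      by (auto simp: bounded_iff)
    obtain C where "\<And>x. x \<in> A \<Longrightarrow> \<bar>divergence (flux f) x\<bar> \<le> C"
      using f.bounded_div by (auto simp: bounded_iff)
    with B closure_subset[of A] show ?thesis by blast
  qed
  obtain B1 C1 where BC1: "\<And>x. x \<in> A \<Longrightarrow> \<bar>u x\<bar> \<le> B1" "\<And>x. x \<in> A \<Longrightarrow> \<bar>divergence (flux u) x\<bar> \<le> C1"
    using bounds[OF u] by blast
  obtain B2 C2 where BC2: "\<And>x. x \<in> A \<Longrightarrow> \<bar>v x\<bar> \<le> B2" "\<And>x. x \<in> A \<Longrightarrow> \<bar>divergence (flux v) x\<bar> \<le> C2"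
    using bounds[OF v] by blast
  define d :: "nat \<Rightarrow> real" where "d n = inverse (Suc n)" for n
  have d_pos: "d n > 0" and d_le: "d n \<le> 1" for n by (auto simp: d_def field_simps)
  have d_lim: "d \<longlonglongrightarrow> 0" unfolding d_def by (rule LIMSEQ_inverse_real_of_nat)
  \<comment> \<open>\<open>P e\<close> collects the gradient terms of both tests with shift
    \<open>e\<close>, and \<open>R e\<close> the reaction terms; for each positive
    \<open>d n\<close> their integrals agree.\<close>
  define R where "R e x = - (((u x + e)\<^sup>2 - (v x + e)\<^sup>2) / (u x + e) * divergence (flux u) x
      + ((v x + e)\<^sup>2 - (u x + e)\<^sup>2) / (v x + e) * divergence (flux v) x)" for e x
  define P where "P e x =
      (grad u x - (2 * ((v x + e) / (u x + e))) *\<^sub>R grad v x + ((v x + e) / (u x + e))\<^sup>2 *\<^sub>R grad u x) \<bullet> flux u x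
    + (grad v x - (2 * ((u x + e) / (v x + e))) *\<^sub>R grad u x + ((u x + e) / (v x + e))\<^sup>2 *\<^sub>R grad v x) \<bullet> flux v x" for e x
  note tu = u.picone_test[OF v d_pos] and tv = v.picone_test[OF u d_pos]
  have P_int: "integrable ?\<mu> (P (d n))" for n
    unfolding P_def using tu(1)[of n] tv(1)[of n] by (rule Bochner_Integration.integrable_add)
  have R_int: "integrable ?\<mu> (R (d n))" for n
    unfolding R_def using tu(2)[of n] tv(2)[of n]
    by (intro Bochner_Integration.integrable_minus Bochner_Integration.integrable_add)
  have P_eq_R: "(\<integral>x. P (d n) x \<partial>?\<mu>) = (\<integral>x. R (d n) x \<partial>?\<mu>)" for n
    unfolding P_def R_def integral_minus
    unfolding Bochner_Integration.integral_add[OF tu(1) tv(1)] Bochner_Integration.integral_add[OF tu(2) tv(2)]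
      tu(3) tv(3)
    by simp
  define E where "E = (B1 + 1) * C1 + (B2 + 1)\<^sup>2 * K + ((B2 + 1) * C2 + (B1 + 1)\<^sup>2 * K)"
  have R_le: "R (d n) x \<le> E" if x: "x \<in> A" for n x
  proof -
    define U V where "U = u x + d n" and "V = v x + d n"
    have UV: "0 < U" "U \<le> B1 + 1" "0 < V" "V \<le> B2 + 1" "u x \<le> U" "v x \<le> V"
      using u.pos[OF x] v.pos[OF x] d_pos[of n] d_le[of n] BC1(1)[OF x] BC2(1)[OF x]
      by (auto simp: U_def V_def)
    \<comment> \<open>The product splits into \<open>S * (- c)\<close>, which is bounded outright,
      and \<open>T\<^sup>2 * (c / S)\<close>, where \<open>c \<le> K * s \<le> K * S\<close> cancels
      the possibly small denominator. \<open>E\<close> is the sum of two such bounds.\<close>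
    have half: "- ((S\<^sup>2 - T\<^sup>2) / S * c) \<le> a * b + t\<^sup>2 * K"
      if "0 < S" "S \<le> a" "0 < T" "T \<le> t" "\<bar>c\<bar> \<le> b" "c \<le> K * s" "s \<le> S" for S T a b c s t :: real
    proof -
      have "- ((S\<^sup>2 - T\<^sup>2) / S * c) = S * (- c) + T\<^sup>2 * (c / S)"
        using that by (simp add: field_simps power2_eq_square)
      moreover have "S * (- c) \<le> a * b"
      proof -
        have "S * (- c) \<le> S * b" using that by (intro mult_left_mono) auto
        also have "\<dots> \<le> a * b" using that by (intro mult_right_mono) auto
        finally show ?thesis .
      qed
      moreover have "T\<^sup>2 * (c / S) \<le> t\<^sup>2 * K"
      proof -
        have "c \<le> K * S" using that K by (meson mult_left_mono order_trans)
        then have "c / S \<le> K" using that by (simp add: divide_le_eq)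
        then have "T\<^sup>2 * (c / S) \<le> T\<^sup>2 * K" by (intro mult_left_mono) auto
        also have "\<dots> \<le> t\<^sup>2 * K" using that K by (intro mult_right_mono power_mono) auto
        finally show ?thesis .
      qed
      ultimately show ?thesis by linarith
    qed
    show ?thesis
      using half[OF UV(1-4) BC1(2)[OF x] u_upper[OF x] UV(5)]
        half[OF UV(3,4,1,2) BC2(2)[OF x] v_upper[OF x] UV(6)]
      unfolding R_def E_def U_def V_def by linarith
  qed
  have R_lim: "(\<lambda>n. max 0 (R (d n) x)) \<longlonglongrightarrow> 0" if x: "x \<in> A" for x
  proof -
    have "(\<lambda>n. R (d n) x) \<longlonglongrightarrow> R 0 x"
      unfolding R_def using u.pos[OF x] v.pos[OF x] d_lim
      by (auto intro!: tendsto_eq_intros)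
    from tendsto_max[OF tendsto_const[of 0] this]
    have lim: "(\<lambda>n. max 0 (R (d n) x)) \<longlonglongrightarrow> max 0 (R 0 x)" .
    have "R 0 x = - (((u x)\<^sup>2 - (v x)\<^sup>2) * (divergence (flux u) x / u x - divergence (flux v) x / v x))"
      using u.pos[OF x] v.pos[OF x] by (simp add: R_def field_simps)
    then have "max 0 (R 0 x) = 0" using mono[OF x] by linarith
    with lim show ?thesis by simp
  qed
  \<comment> \<open>\<open>R_le\<close> bounds \<open>R (d n)\<close> only from above, so the limit
    is taken for the positive part.\<close>
  have R_pos_lim: "(\<lambda>n. \<integral>x. max 0 (R (d n) x) \<partial>?\<mu>) \<longlonglongrightarrow> (\<integral>x. 0 \<partial>?\<mu>)"
  proof (rule integral_dominated_convergence[where w = "\<lambda>x. \<bar>E\<bar>"])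
    show "(\<lambda>x. max 0 (R (d n) x)) \<in> borel_measurable ?\<mu>" for n
      using R_int[of n] by auto
    show "AE x in ?\<mu>. norm (max 0 (R (d n) x)) \<le> \<bar>E\<bar>" for n
    proof (rule AE)
      fix x assume "x \<in> A"
      from R_le[OF this, of n] show "norm (max 0 (R (d n) x)) \<le> \<bar>E\<bar>"
        by (auto simp: max_def)
    qed
  qed (auto intro: AE R_lim)
  \<comment> \<open>The integral of such a \<open>Q\<close> lies between 0 and the integral of the
    positive part of \<open>R (d n)\<close> for every \<open>n\<close>, hence is 0; continuity turns
    vanishing almost everywhere into vanishing everywhere. Used twice, once for each Picone
    bound.\<close>
  have vanish: "Q x = 0"
    if Q: "continuous_on A Q" "\<And>x. x \<in> A \<Longrightarrow> 0 \<le> Q x" "\<And>n x. x \<in> A \<Longrightarrow> Q x \<le> P (d n) x"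
      and x: "x \<in> A" for Q x
  proof -
    have Q_int: "integrable ?\<mu> Q"
    proof (rule Bochner_Integration.integrable_bound[OF P_int[of 0] measurable_continuous_lborel_restrict[OF Q(1)]], rule AE)
      fix x assume "x \<in> A"
      from Q(2)[OF this] Q(3)[OF this, of 0] show "norm (Q x) \<le> norm (P (d 0) x)"
        by simp
    qed
    have "(\<integral>x. Q x \<partial>?\<mu>) \<le> (\<integral>x. max 0 (R (d n) x) \<partial>?\<mu>)" for n
    proof -
      have "(\<integral>x. Q x \<partial>?\<mu>) \<le> (\<integral>x. P (d n) x \<partial>?\<mu>)"
        using Q(3) in_A by (intro integral_mono Q_int P_int) auto
      also have "\<dots> \<le> (\<integral>x. max 0 (R (d n) x) \<partial>?\<mu>)"
        unfolding P_eq_R using R_int[of n] by (intro integral_mono) auto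
      finally show ?thesis .
    qed
    then have "(\<integral>x. Q x \<partial>?\<mu>) \<le> 0"
      using LIMSEQ_le_const[OF R_pos_lim] by auto
    moreover have "0 \<le> (\<integral>x. Q x \<partial>?\<mu>)"
      using Q(2) in_A by (intro integral_nonneg_AE AE)
    ultimately have "AE x in ?\<mu>. Q x = 0"
      using integral_nonneg_eq_0_iff_AE[OF Q_int AE[OF Q(2)]] by simp
    then show ?thesis
      by (rule AE_zero_imp_zero_on_open[OF u.open_A Q(1) _ x])
  qed
  define a where "a f x = inverse (sqrt (1 - (norm (grad f x))\<^sup>2))" for f and x :: 'a
  have P_eq: "P e x = a u x * ((grad u x - (2 * r) *\<^sub>R grad v x + r\<^sup>2 *\<^sub>R grad u x) \<bullet> grad u x)
      + a v x * ((grad v x - (2 / r) *\<^sub>R grad u x + (1 / r)\<^sup>2 *\<^sub>R grad v x) \<bullet> grad v x)"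
    if "r = (v x + e) / (u x + e)" for e x r
    using that by (simp add: P_def a_def)
  have r_pos: "0 < (v x + d n) / (u x + d n)" if "x \<in> A" for x n
    using u.pos[OF that] v.pos[OF that] d_pos[of n] by simp
  have a_ge: "1 \<le> a u x" "1 \<le> a v x" if "x \<in> A" for x
    unfolding a_def using u.inverse_sqrt_ge_1[OF that] v.inverse_sqrt_ge_1[OF that] by auto
  note cont_grad = C1_gradient_onD(2)[OF u.C1_grad] C1_gradient_onD(2)[OF v.C1_grad]
  have a_cont: "continuous_on A (a u)" "continuous_on A (a v)"
    unfolding a_def using u.sqrt_pos v.sqrt_pos
    by (intro continuous_intros cont_grad; force)+
  have norm_eq: "norm (grad u x) = norm (grad v x)" if x: "x \<in> A" for x
  proof -
    \<comment> \<open>The lower bound of \<open>picone_lower_bound\<close>. As the weight is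
      strictly increasing in the norm of the gradient, \<open>Q\<close> is nonnegative and vanishes
      only where the norms agree.\<close>
    define Q where "Q x = (a u x - a v x) * ((norm (grad u x))\<^sup>2 - (norm (grad v x))\<^sup>2)" for x
    note mono = inverse_sqrt_monotone[OF norm_ge_zero u.spacelike norm_ge_zero v.spacelike]
    have "Q x = 0"
    proof (rule vanish[OF _ _ _ x])
      show "continuous_on A Q"
        unfolding Q_def by (intro continuous_intros a_cont cont_grad)
      show "0 \<le> Q x" if "x \<in> A" for x
        using mono(1)[OF that that] by (simp add: Q_def a_def)
      show "Q x \<le> P (d n) x" if "x \<in> A" for n x
        unfolding Q_def P_eq[OF refl]
        using a_ge[OF that] r_pos[OF that] by (intro picone_lower_bound) auto
    qed
    then show ?thesis
      unfolding Q_def a_def by (rule mono(2)[OF x x])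
  qed
  have grad_eq: "grad u x = grad v x" if x: "x \<in> A" for x
  proof -
    \<comment> \<open>Equal norms make the weights equal, so the second Picone bound applies and
      also fixes the directions.\<close>
    have "2 * (norm (grad u x - grad v x))\<^sup>2 = 0"
    proof (rule vanish[where Q = "\<lambda>x. 2 * (norm (grad u x - grad v x))\<^sup>2", OF _ _ _ x])
      show "continuous_on A (\<lambda>x. 2 * (norm (grad u x - grad v x))\<^sup>2)"
        by (intro continuous_intros cont_grad)
      fix n x assume x: "x \<in> A"
      have "a v x = a u x" using norm_eq[OF x] by (simp add: a_def)
      then show "2 * (norm (grad u x - grad v x))\<^sup>2 \<le> P (d n) x"
        unfolding P_eq[OF refl]
        using picone_lower_bound_eq_norm[OF a_ge(1)[OF x] r_pos[OF x] norm_eq[OF x]] by simp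
    qed simp
    then show ?thesis by simp
  qed
  have "((\<lambda>x. u x - v x) has_derivative (\<lambda>h. 0)) (at x)" if "x \<in> A" for x
    using has_derivative_diff[OF C1_gradient_onD(1)[OF u.C1_grad that] C1_gradient_onD(1)[OF v.C1_grad that]]
    by (simp add: grad_eq[OF that])
  then have "(\<lambda>x. u x - v x) constant_on A"
    by (intro has_derivative_zero_connected_constant_on[OF conn u.open_A finite.emptyI] continuous_on_diff
        C1_gradient_onD(3)[OF u.C1_grad] C1_gradient_onD(3)[OF v.C1_grad])
      (auto intro: has_derivative_at_withinI)
  then obtain c where c: "\<And>x. x \<in> A \<Longrightarrow> u x - v x = c"
    by (auto simp: constant_on_def)
  have cl: "u x - v x = c" if "x \<in> closure A" for x
    by (rule continuous_constant_on_closure[OF _ c that]) (intro continuous_intros u.cont v.cont)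
  \<comment> \<open>A nonempty bounded open set has a frontier point, and there both functions are
    0, which determines the constant.\<close>
  have "A \<noteq> UNIV" using u.bounded_A by auto
  then obtain y where "y \<in> frontier A"
    using ne frontier_eq_empty[of A] by auto
  then have "c = 0"
    using cl[of y] u.frontier_0[of y] v.frontier_0[of y] by (auto simp: frontier_def)
  then show ?thesis using cl[OF x] by simp
qed

section \<open>Reduction of the boundary value problem to the uniqueness result for spacelike
  functions\<close>

theorem theorem5p2:
  fixes \<Omega> :: "'a::euclidean_space set"
    and g g1 g2 G :: "'a \<Rightarrow> real \<Rightarrow> real"
    and M :: real
  assumes "bounded_smooth_domain \<Omega>"
    and "M = diameter (closure \<Omega>) / 2"
    and "\<And>x t. G x t = integral {0..t} (g x)"
    and "\<And>x. x \<in> \<Omega> \<Longrightarrow> concave_on {0..M\<^sup>2} (\<lambda>t. G x (sqrt t))"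
    and "continuous_on (closure \<Omega> \<times> {0..M}) (\<lambda>(x, t). g x t)"
    and "\<And>x t. x \<in> closure \<Omega> \<Longrightarrow> t \<in> {0..M} \<Longrightarrow> g x t = g1 x t + g2 x t"
    and "\<And>x. x \<in> closure \<Omega> \<Longrightarrow> g1 x 0 = 0"
    and "\<And>x. x \<in> closure \<Omega> \<Longrightarrow> g2 x 0 = 0"
    and "\<exists>L. \<forall>x\<in>closure \<Omega>. L-lipschitz_on {0..M} (g1 x)"
    and "continuous_on (closure \<Omega> \<times> {0..M}) (\<lambda>(x, t). g2 x t)"
    and "\<And>x t. x \<in> closure \<Omega> \<Longrightarrow> t \<in> {0..M} \<Longrightarrow> g2 x t \<ge> 0"
    and "positive_classical_solution \<Omega> g u"
    and "positive_classical_solution \<Omega> g v"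
  shows "\<forall>x\<in>closure \<Omega>. u x = v x"
proof -
  have \<Omega>: "open \<Omega>" "connected \<Omega>" "bounded \<Omega>" "\<Omega> \<noteq> {}"
    using assms(1) by (auto simp: bounded_smooth_domain_def)
  obtain L where L: "\<And>x. x \<in> closure \<Omega> \<Longrightarrow> L-lipschitz_on {0..M} (g1 x)"
    using assms(9) by blast
  have "compact (closure \<Omega> \<times> {0..M})"
    using \<Omega> by (intro compact_Times) (auto simp: compact_closure)
  then have "bounded ((\<lambda>(x, t). g x t) ` (closure \<Omega> \<times> {0..M}))"
    by (intro compact_imp_bounded compact_continuous_image assms(5))
  then obtain C where C: "\<And>x t. x \<in> closure \<Omega> \<Longrightarrow> t \<in> {0..M} \<Longrightarrow> \<bar>g x t\<bar> \<le> C"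
    by (force simp: bounded_iff)
  have sol: "spacelike_function \<Omega> w
      \<and> (\<forall>x\<in>\<Omega>. 0 < w x \<and> w x < M \<and> divergence (flux w) x = - g x (w x) \<and> - g x (w x) \<le> L * w x)"
    if w: "positive_classical_solution \<Omega> g w" for w
  proof -
    have w': "continuous_on (closure \<Omega>) w" "Ck_on 2 \<Omega> w"
      "\<And>x. x \<in> \<Omega> \<Longrightarrow> 0 < w x" "\<And>x. x \<in> \<Omega> \<Longrightarrow> norm (grad w x) < 1"
      "\<And>x. x \<in> frontier \<Omega> \<Longrightarrow> w x = 0"
      and eq: "\<And>x. x \<in> \<Omega> \<Longrightarrow> divergence (flux w) x = - g x (w x)"
      using w by (auto simp: positive_classical_solution_def C2_Holder_closure_def minus_equation_iff)
    have less: "w x < M" if "x \<in> \<Omega>" for x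
      unfolding assms(2)
      by (rule spacelike_less_half_diameter[OF \<Omega>(1,3) w'(1,5) Ck_on_2_grad(1)[OF w'(2)] w'(4) that])
    have "\<bar>divergence (flux w) x\<bar> \<le> C" if "x \<in> \<Omega>" for x
      using C[of x "w x"] w'(3)[OF that] less[OF that] that closure_subset[of \<Omega>] eq[OF that] by auto
    then have "bounded (divergence (flux w) ` \<Omega>)"
      by (intro boundedI[where B = C]) auto
    then have "spacelike_function \<Omega> w"
      using \<Omega> w' by unfold_locales
    \<comment> \<open>\<open>g2\<close> is nonnegative, so only \<open>g1\<close> can make
      \<open>g\<close> negative, and it is at least \<open>- L * w x\<close> by the Lipschitz bound
      from its value 0 at 0.\<close>
    moreover have "- g x (w x) \<le> L * w x" if x: "x \<in> \<Omega>" for x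
    proof -
      have cl: "x \<in> closure \<Omega>" using x closure_subset by auto
      have t: "w x \<in> {0..M}" "0 \<in> {0..M}" using w'(3)[OF x] less[OF x] by auto
      have "\<bar>g1 x (w x) - g1 x 0\<bar> \<le> L * \<bar>w x - 0\<bar>"
        using lipschitz_onD[OF L[OF cl] t] by (simp add: dist_real_def)
      then show ?thesis
        using assms(6)[OF cl t(1)] assms(7)[OF cl] assms(11)[OF cl t(1)] w'(3)[OF x] by auto
    qed
    ultimately show ?thesis using w'(3) less eq by blast
  qed
  note su = sol[OF assms(12)] and sv = sol[OF assms(13)]
  have quotient: "g x b / b \<le> g x a / a" if "x \<in> \<Omega>" "0 < a" "a \<le> b" "b < M" for x a b
  proof (rule concave_quotient_decreasing[OF _ _ that(2-4)])
    show "concave_on {0..M\<^sup>2} (\<lambda>t. integral {0..sqrt t} (g x))"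
      using assms(4)[OF that(1)] by (simp add: assms(3))
    have "x \<in> closure \<Omega>" using that closure_subset by auto
    then show "continuous_on {0..M} (g x)"
      using continuous_on_compose2[OF assms(5) continuous_on_Pair[OF continuous_on_const[of _ x] continuous_on_id], of "{0..M}"]
      by auto
  qed
  \<comment> \<open>After inserting the equations the second factor is
    \<open>g x (v x) / v x - g x (u x) / u x\<close>; since the quotient decreases in its argument,
    both factors have the same sign.\<close>
  have "0 \<le> ((u x)\<^sup>2 - (v x)\<^sup>2) * (divergence (flux u) x / u x - divergence (flux v) x / v x)"
    if x: "x \<in> \<Omega>" for x
  proof -
    have uv: "0 < u x" "u x < M" "0 < v x" "v x < M"
      and eq: "divergence (flux u) x = - g x (u x)" "divergence (flux v) x = - g x (v x)"
      using su sv x by auto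
    show ?thesis
    proof (cases "u x \<le> v x")
      case True
      then show ?thesis
        using quotient[OF x uv(1) True uv(4)] uv power_mono[OF True, of 2] unfolding eq
        by (intro mult_nonpos_nonpos) auto
    next
      case False
      then have le: "v x \<le> u x" by simp
      then show ?thesis
        using quotient[OF x uv(3) le uv(2)] uv power_mono[OF le, of 2] unfolding eq
        by (intro mult_nonneg_nonneg) auto
    qed
  qed
  moreover have "0 \<le> L"
    using L \<Omega>(4) closure_subset[of \<Omega>] lipschitz_on_nonneg by blast
  ultimately show ?thesis
    using su sv \<Omega> by (intro ballI spacelike_unique[where K = L]) auto
qed

end
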